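(* Let $X$ be a complex Banach space with open unit ball $\mathbb{B}$, let $f:\mathbb{B}\to\mathbb{C}$ be holomorphic with $f(0)=1$, and let $F:\mathbb{B}\to X$ be given by $F(x)=f(x)x$. For each $u\in\partial\mathbb{B}$ put $f_u(\zeta)=\zeta f(\zeta u)$, $|\zeta|<1$. Let $r\in(0,1)$ be fixed. Then $F$ is a quasi-convex mapping of type $B$ on $B_r$ if and only if $f_u$ is convex on $\mathbb{U}_r$ for all $u\in\partial\mathbb{B}$.
   Context: $B_r=\{x\in X:\|x\|<r\}$, $\mathbb{U}_r=\{\zeta\in\mathbb{C}:|\zeta|<r\}$, $\partial\mathbb{B}=\{x\in X:\|x\|=1\}$. $DF(x)$ and $D^2F(x)$ denote the first and second Fréchet derivatives of $F$ at $x$, and $D^2F(x)(x^2)=D^2F(x)(x,x)$. For $x\in X\setminus\{0\}$, $T(x)$ is the set of continuous linear functionals $l_x:X\to\mathbb{C}$ with $l_x(x)=\|x\|$ and $\|l_x\|=1$. $F$ is normalized if $F(0)=0$ and $DF(0)=I$ (identity). A normalized holomorphic mapping $F$ is quasi-convex of type $B$ on $B_r$ if it is locally biholomorphic on $B_r$ (i.e. $DF(x)$ is invertible with bounded inverse for each $x\in B_r$) and $$\Re\, l_x\left([DF(x)]^{-1}\left(D^2F(x)(x^2)+DF(x)x\right)\right)>0\quad\text{for all }x\in B_r\setminus\{0\},\ l_x\in T(x).$$ A holomorphic function is convex on $\mathbb{U}_r$ if it is univalent (injective) on $\mathbb{U}_r$ and maps $\mathbb{U}_r$ onto a convex domain.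 *)

theory Defs
  imports "HOL-Complex_Analysis.Complex_Analysis"
begin

class complex_normed_vector = real_normed_vector +
  fixes scaleC :: "complex \<Rightarrow> 'a \<Rightarrow> 'a"  (infixr "*\<^sub>C" 75)
  assumes scaleC_add_right: "a *\<^sub>C (x + y) = a *\<^sub>C x + a *\<^sub>C y"
    and scaleC_add_left: "(a + b) *\<^sub>C x = a *\<^sub>C x + b *\<^sub>C x"
    and scaleC_scaleC: "a *\<^sub>C (b *\<^sub>C x) = (a * b) *\<^sub>C x"
    and scaleR_eq_scaleC: "t *\<^sub>R x = complex_of_real t *\<^sub>C x"
    and norm_scaleC: "norm (a *\<^sub>C x) = cmod a * norm x"

class complex_banach = complex_normed_vector + banach

instantiation complex :: complex_banach
begin

definition scaleC_complex :: "complex \<Rightarrow> complex \<Rightarrow> complex" where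
  "scaleC_complex a x = a * x"

instance
  by standard
    (simp_all add: scaleC_complex_def algebra_simps norm_mult scaleR_conv_of_real)

end

definition bounded_clinear ::
    "('a::complex_normed_vector \<Rightarrow> 'b::complex_normed_vector) \<Rightarrow> bool" where
  "bounded_clinear L \<longleftrightarrow> bounded_linear L \<and> (\<forall>c x. L (c *\<^sub>C x) = c *\<^sub>C L x)"

definition banach_holomorphic_on ::
    "('a::complex_normed_vector \<Rightarrow> 'b::complex_normed_vector) \<Rightarrow> 'a set \<Rightarrow> bool" where
  "banach_holomorphic_on F S \<longleftrightarrow>
     (\<forall>x\<in>S. \<exists>L. bounded_clinear L \<and> (F has_derivative L) (at x within S))"

text \<open>
  At a point where a map is complex Frechet differentiable, its real Frechet derivative is
  the complex one, so the library's derivative is used for $DF$ and $D^2F$.  The second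
  derivative is the derivative of $y \mapsto DF(y)$ with respect to the operator norm.
\<close>

abbreviation frechet_D ::
    "('a::complex_normed_vector \<Rightarrow> 'b::complex_normed_vector) \<Rightarrow> 'a \<Rightarrow> 'a \<Rightarrow> 'b" where
  "frechet_D F x \<equiv> frechet_derivative F (at x)"

definition frechet_D2 ::
    "('a::complex_normed_vector \<Rightarrow> 'b::complex_normed_vector) \<Rightarrow> 'a \<Rightarrow> 'a \<Rightarrow> 'a \<Rightarrow> 'b" where
  "frechet_D2 F x h k =
     blinfun_apply (frechet_derivative (\<lambda>y. Blinfun (frechet_D F y)) (at x) h) k"

definition support_functionals :: "'a::complex_normed_vector \<Rightarrow> ('a \<Rightarrow> complex) set" where
  "support_functionals x =
     {l. bounded_clinear l \<and> l x = complex_of_real (norm x) \<and> onorm l = 1}"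

definition normalized_map ::
    "('a::complex_normed_vector \<Rightarrow> 'a) \<Rightarrow> bool" where
  "normalized_map F \<longleftrightarrow> F 0 = 0 \<and> frechet_D F 0 = id"

definition locally_biholomorphic_on ::
    "('a::complex_normed_vector \<Rightarrow> 'b::complex_normed_vector) \<Rightarrow> 'a set \<Rightarrow> bool" where
  "locally_biholomorphic_on F S \<longleftrightarrow>
     banach_holomorphic_on F S \<and>
     (\<forall>x\<in>S. bij (frechet_D F x) \<and> bounded_clinear (inv (frechet_D F x)))"

definition quasi_convex_type_B ::
    "('a::complex_normed_vector \<Rightarrow> 'a) \<Rightarrow> real \<Rightarrow> bool" where
  "quasi_convex_type_B F r \<longleftrightarrow>
     normalized_map F \<and> locally_biholomorphic_on F (ball 0 r) \<and>
     (\<forall>x \<in> ball 0 r - {0}. \<forall>l \<in> support_functionals x.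
        Re (l (inv (frechet_D F x) (frechet_D2 F x x x + frechet_D F x x))) > 0)"

definition convex_function_on_disc :: "(complex \<Rightarrow> complex) \<Rightarrow> real \<Rightarrow> bool" where
  "convex_function_on_disc g r \<longleftrightarrow>
     g holomorphic_on ball 0 r \<and> inj_on g (ball 0 r) \<and>
     open (g ` ball 0 r) \<and> connected (g ` ball 0 r) \<and> convex (g ` ball 0 r)"

end

theory Submission imports Defs begin

text \<open>
  On the complex line through a unit vector \<open>u\<close> the map \<open>F(x) = f(x)x\<close> acts as the function
  \<open>f\<^sub>u(\<zeta>) = \<zeta> f(\<zeta>u)\<close>: at \<open>x = \<zeta>u\<close> one has \<open>DF(x)x = \<zeta> f\<^sub>u'(\<zeta>) u\<close> and
  \<open>D\<^sup>2F(x)(x\<^sup>2) = \<zeta>\<^sup>2 f\<^sub>u''(\<zeta>) u\<close>, so the quantity in the definition of quasi-convexity equals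
  \<open>\<bar>\<zeta>\<bar> (1 + \<zeta> f\<^sub>u''(\<zeta>) / f\<^sub>u'(\<zeta>))\<close> for every support functional.  Transversally \<open>DF(x)\<close> is a
  rank-one perturbation of \<open>f(x) I\<close>, hence invertible as soon as \<open>f(x)\<close> and \<open>f\<^sub>u'(\<zeta>)\<close> do not
  vanish, and the theorem reduces to the classical criterion \<open>Re (1 + \<zeta> g''/g') > 0\<close> for convex
  functions.  Support functionals exist by the Hahn-Banach theorem, and the second Frechet
  derivative exists in operator norm by Cauchy estimates along complex lines.
\<close>

subsection \<open>Cauchy estimates and the second Frechet derivative\<close>

text \<open>Only one complex derivative of \<open>f\<close> is assumed, while
  \<open>frechet_D2\<close> rests on a choice operator that says nothing until y -> DF(y) is known
  to be differentiable in operator norm. So a remainder estimate uniform over all directions is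
  needed, although X may be infinite-dimensional. It comes from a single local bound on |f|: a
  Cauchy estimate on a disc scaled to the length of a direction sees that direction only through its
  norm. Only the scalar \<open>f\<close> needs this work; F follows by the product rule.

  The classical criterion is geometric. Re (1 + z g''/g') is the speed at which the tangent to the
  image of a circle about 0 turns. If it is positive, each image point of a circle has a strict
  supporting line, and this gives univalence and convexity together. Conversely, convexity of the
  image lets one average two rotated copies of g and pull the average back to a self-map of the
  disc, where Schwarz's lemma applies.

  Univalence of f_u yields both conditions for inverting DF(x): a zero of f off the origin would be
  a second zero of f_u, and f_u' cannot vanish.\<close>

lemma bounded_bilinear_scaleC:
  "bounded_bilinear (scaleC :: complex \<Rightarrow> 'a::complex_normed_vector \<Rightarrow> 'a)"
proof
  fix a b :: complex and x y :: 'a and t :: real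
  show "(a + b) *\<^sub>C x = a *\<^sub>C x + b *\<^sub>C x" "a *\<^sub>C (x + y) = a *\<^sub>C x + a *\<^sub>C y"
    by (rule scaleC_add_left, rule scaleC_add_right)
  show "(t *\<^sub>R a) *\<^sub>C x = t *\<^sub>R a *\<^sub>C x" "a *\<^sub>C t *\<^sub>R x = t *\<^sub>R a *\<^sub>C x"
    by (simp_all add: scaleR_eq_scaleC[of t x] scaleR_eq_scaleC[of t "a *\<^sub>C x"] scaleC_scaleC
        scaleR_conv_of_real mult.commute)
  show "\<exists>K. \<forall>a x. norm (a *\<^sub>C (x::'a)) \<le> norm a * norm x * K"
    by (intro exI[of _ 1]) (simp add: norm_scaleC)
qed

interpretation scaleC: bounded_bilinear "scaleC :: complex \<Rightarrow> 'a::complex_normed_vector \<Rightarrow> 'a"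
  by (rule bounded_bilinear_scaleC)

declare scaleC.zero_left [simp] scaleC.zero_right [simp]

lemma scaleC_one [simp]: "1 *\<^sub>C x = (x :: 'a::complex_normed_vector)"
  using scaleR_eq_scaleC[of 1 x] by simp

lemma bounded_clinearD:
  assumes "bounded_clinear L"
  shows "bounded_linear L" "L (c *\<^sub>C x) = c *\<^sub>C L x"
  using assms unfolding bounded_clinear_def by auto

lemma bounded_clinear_complexD:
  fixes L :: "'a::complex_normed_vector \<Rightarrow> complex"
  assumes "bounded_clinear L"
  shows "L (c *\<^sub>C x) = c * L x"
  using bounded_clinearD(2)[OF assms, of c x] by (simp add: scaleC_complex_def)

text \<open>Cauchy's inequality on circles of radius 1/4 about points of modulus at most 1/2 bounds
  the n-th derivative by n! 4^n K, which is 4 K and 32 K for n = 1, 2. The remainder in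
  \<open>complex_Taylor\<close> is divided by \<open>fact n\<close> at order n, so 32 K passes
  through without the usual factor 1/2.\<close>

lemma cauchy_first_order:
  fixes g :: "complex \<Rightarrow> complex"
  assumes hol: "g holomorphic_on ball 0 1"
    and bd: "\<And>s. s \<in> ball 0 1 \<Longrightarrow> norm (g s) \<le> K"
    and s: "norm s \<le> 1/2"
  shows "norm (deriv g 0) \<le> 4 * K"
    and "norm (g s - g 0) \<le> 4 * K * norm s"
    and "norm (g s - g 0 - s * deriv g 0) \<le> 32 * K * (norm s)\<^sup>2"
proof -
  have D: "norm ((deriv ^^ n) g z) \<le> fact n * K / (1/4)^n" if "z \<in> cball 0 (1/2)" for z n
  proof (rule Cauchy_inequality)
    have sub: "cball z (1/4) \<subseteq> ball 0 1"
    proof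
      fix w assume "w \<in> cball z (1/4)"
      then have "norm (w - z) \<le> 1/4" by (simp add: dist_norm norm_minus_commute)
      moreover have "norm w \<le> norm (w - z) + norm z" by (metis norm_triangle_sub add.commute)
      ultimately show "w \<in> ball 0 1" using that by simp
    qed
    then show "g holomorphic_on ball z (1/4)"
      using hol ball_subset_cball holomorphic_on_subset by blast
    show "continuous_on (cball z (1/4)) g"
      using sub hol continuous_on_subset holomorphic_on_imp_continuous_on by blast
    fix w assume "norm (z - w) = 1/4"
    then have "w \<in> cball z (1/4)" by (simp add: dist_norm)
    then show "norm (g w) \<le> K" using sub by (intro bd) blast
  qed simp
  show "norm (deriv g 0) \<le> 4 * K" using D[of 0 1] by (simp add: mult.commute)
  have der: "((deriv ^^ n) g has_field_derivative (deriv ^^ Suc n) g z) (at z within cball 0 (1/2))"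
    if "z \<in> cball 0 (1/2)" for z n
  proof -
    have "(deriv ^^ n) g holomorphic_on ball 0 1"
      by (rule holomorphic_higher_deriv[OF hol]) simp
    then have "((deriv ^^ n) g has_field_derivative deriv ((deriv ^^ n) g) z) (at z)"
      by (rule holomorphic_derivI) (use that in auto)
    then show ?thesis by (simp add: has_field_derivative_at_within)
  qed
  have b: "0 \<in> cball (0::complex) (1/2)" "s \<in> cball 0 (1/2)" using s by auto
  have D1: "norm ((deriv ^^ Suc 0) g z) \<le> 4 * K" and D2: "norm ((deriv ^^ Suc 1) g z) \<le> 32 * K"
    if "z \<in> cball 0 (1/2)" for z
    using D[OF that, of 1] D[OF that, of 2] by (simp_all add: mult.commute numeral_2_eq_2)
  have "norm ((deriv ^^ 0) g s - (\<Sum>i\<le>0. (deriv ^^ i) g 0 * (s - 0) ^ i / fact i))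
      \<le> 4 * K * norm (s - 0) ^ Suc 0 / fact 0"
    by (rule complex_Taylor[where f = "\<lambda>n. (deriv ^^ n) g", OF convex_cball der D1 b])
  then show "norm (g s - g 0) \<le> 4 * K * norm s" by simp
  have "norm ((deriv ^^ 0) g s - (\<Sum>i\<le>1. (deriv ^^ i) g 0 * (s - 0) ^ i / fact i))
      \<le> 32 * K * norm (s - 0) ^ Suc 1 / fact 1"
    by (rule complex_Taylor[where f = "\<lambda>n. (deriv ^^ n) g", OF convex_cball der D2 b])
  then show "norm (g s - g 0 - s * deriv g 0) \<le> 32 * K * (norm s)\<^sup>2"
    by (simp add: power2_eq_square algebra_simps)
qed

text \<open>This is Gateaux holomorphy. Directional derivatives inherit it before anything is known
  about their Frechet differentiability, so the Cauchy estimates can be iterated.\<close>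

definition line_holomorphic_on :: "('a::complex_normed_vector \<Rightarrow> complex) \<Rightarrow> 'a set \<Rightarrow> bool" where
  "line_holomorphic_on G S \<longleftrightarrow>
     (\<forall>y k. (\<lambda>s. G (y + s *\<^sub>C k)) holomorphic_on {s. y + s *\<^sub>C k \<in> S})"

definition line_deriv :: "('a::complex_normed_vector \<Rightarrow> complex) \<Rightarrow> 'a \<Rightarrow> 'a \<Rightarrow> complex" where
  "line_deriv G y k = deriv (\<lambda>s. G (y + s *\<^sub>C k)) 0"

lemma line_holomorphic_on_subset:
  assumes "line_holomorphic_on G S" "T \<subseteq> S"
  shows "line_holomorphic_on G T"
  unfolding line_holomorphic_on_def
proof (intro allI)
  fix y k
  show "(\<lambda>s. G (y + s *\<^sub>C k)) holomorphic_on {s. y + s *\<^sub>C k \<in> T}"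
    by (rule holomorphic_on_subset[OF assms(1)[unfolded line_holomorphic_on_def, rule_format]])
      (use assms(2) in auto)
qed

lemma open_line_vimage:
  assumes "open S"
  shows "open {s. y + s *\<^sub>C (k::'a::complex_normed_vector) \<in> S}"
proof -
  have "continuous_on UNIV (\<lambda>s. y + s *\<^sub>C k)"
    by (intro continuous_intros scaleC.continuous_on)
  from open_vimage[OF assms this] show ?thesis by (simp add: vimage_def)
qed

lemma line_has_deriv:
  assumes "line_holomorphic_on G S" "open S" "y \<in> S"
  shows "((\<lambda>s. G (y + s *\<^sub>C k)) has_field_derivative line_deriv G y k) (at 0)"
  unfolding line_deriv_def
  by (rule holomorphic_derivI[OF assms(1)[unfolded line_holomorphic_on_def, rule_format] open_line_vimage[OF assms(2)]])
    (use assms in auto)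

lemma line_deriv_eqI:
  assumes "((\<lambda>s. G (y + s *\<^sub>C k)) has_field_derivative d) (at 0)"
  shows "line_deriv G y k = d"
  unfolding line_deriv_def by (rule DERIV_imp_deriv[OF assms])

lemma line_deriv_scaleC:
  assumes "line_holomorphic_on G S" "open S" "y \<in> S"
  shows "line_deriv G y (c *\<^sub>C k) = c * line_deriv G y k"
proof (rule line_deriv_eqI)
  have "((\<lambda>s. G (y + s *\<^sub>C k)) \<circ> (\<lambda>s. s * c) has_field_derivative line_deriv G y k * c) (at 0)"
    by (rule DERIV_chain) (use line_has_deriv[OF assms, of k] in \<open>auto intro!: derivative_eq_intros\<close>)
  then show "((\<lambda>s. G (y + s *\<^sub>C c *\<^sub>C k)) has_field_derivative c * line_deriv G y k) (at 0)"
    by (simp add: o_def scaleC_scaleC mult.commute)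
qed

text \<open>The direction is rescaled to \<open>e\<close> of norm R/2, so that the unit disc in
  direction \<open>e\<close> about \<open>y\<close> stays in the ball and
  \<open>cauchy_first_order\<close> applies at s = 2 |k| / R. Hence 8 = 4 * 2 and 128 = 32 * 2^2,
  and |k| \<le> R/4 says |s| \<le> 1/2.\<close>

lemma line_cauchy:
  fixes G :: "'a::complex_normed_vector \<Rightarrow> complex"
  assumes hol: "line_holomorphic_on G (ball x R)" and R: "R > 0"
    and bd: "\<And>y. y \<in> ball x R \<Longrightarrow> norm (G y) \<le> K"
    and y: "y \<in> ball x (R/2)"
  shows "norm (line_deriv G y k) \<le> 8 * K / R * norm k"
    and "norm k \<le> R/4 \<Longrightarrow> norm (G (y + k) - G y) \<le> 8 * K / R * norm k"
    and "norm k \<le> R/4 \<Longrightarrow> norm (G (y + k) - G y - line_deriv G y k) \<le> 128 * K / R\<^sup>2 * (norm k)\<^sup>2"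
proof -
  have yR: "y \<in> ball x R" using y R by auto
  have "norm (line_deriv G y k) \<le> 8 * K / R * norm k \<and> (norm k \<le> R/4 \<longrightarrow>
      norm (G (y + k) - G y) \<le> 8 * K / R * norm k \<and>
      norm (G (y + k) - G y - line_deriv G y k) \<le> 128 * K / R\<^sup>2 * (norm k)\<^sup>2)"
  proof (cases "k = 0")
    case True
    have "line_deriv G y 0 = 0"
      by (rule line_deriv_eqI) simp
    then show ?thesis using True by simp
  next
    case False
    define c where "c = R / (2 * norm k)"
    have c: "c > 0" using False R by (simp add: c_def)
    define e where "e = complex_of_real c *\<^sub>C k"
    have e: "norm e = R/2"
    proof -
      have "norm e = c * norm k" using c by (simp add: e_def norm_scaleC)
      then show ?thesis using False by (simp add: c_def)
    qed
    have k: "k = complex_of_real (1/c) *\<^sub>C e" using c by (simp add: e_def scaleC_scaleC)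
    have mem: "y + s *\<^sub>C e \<in> ball x R" if "norm s < 1" for s
    proof -
      have "norm (y + s *\<^sub>C e - x) \<le> norm (y - x) + norm (s *\<^sub>C e)"
        by (metis add_diff_eq add.commute diff_add_eq norm_triangle_ineq)
      also have "norm (s *\<^sub>C e) \<le> 1 * (R/2)" unfolding norm_scaleC e
        using that R by (intro mult_right_mono) auto
      also have "norm (y - x) < R/2" using y by (simp add: dist_norm norm_minus_commute)
      finally show ?thesis by (simp add: dist_norm norm_minus_commute)
    qed
    define g where "g = (\<lambda>s. G (y + s *\<^sub>C e))"
    have g: "g holomorphic_on ball 0 1"
      unfolding g_def
      by (rule holomorphic_on_subset[OF hol[unfolded line_holomorphic_on_def, rule_format]])
        (use mem in auto)
    have gb: "norm (g s) \<le> K" if "s \<in> ball 0 1" for s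
      unfolding g_def using that by (intro bd mem) auto
    have g': "deriv g 0 = line_deriv G y e" by (simp add: g_def line_deriv_def)
    have dk: "line_deriv G y k = complex_of_real (1/c) * deriv g 0"
      unfolding g' by (subst k) (rule line_deriv_scaleC[OF hol open_ball yR])
    have ck: "1/c = 2 / R * norm k" by (simp add: c_def)
    have n: "norm (complex_of_real (1/c)) = 2 / R * norm k"
      using c ck by (metis less_imp_le norm_of_real abs_of_nonneg zero_le_divide_1_iff)
    have A: "norm (line_deriv G y k) \<le> 8 * K / R * norm k"
    proof -
      have "norm (line_deriv G y k) \<le> (2 / R * norm k) * (4 * K)"
        unfolding dk norm_mult n
        by (rule mult_left_mono[OF cauchy_first_order(1)[OF g gb, of 0]]) (use R in auto)
      then show ?thesis by (simp add: mult_ac)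
    qed
    moreover have "norm (G (y + k) - G y) \<le> 8 * K / R * norm k \<and>
      norm (G (y + k) - G y - line_deriv G y k) \<le> 128 * K / R\<^sup>2 * (norm k)\<^sup>2" if kR: "norm k \<le> R/4"
    proof -
      have small: "norm (complex_of_real (1/c)) \<le> 1/2" unfolding n using kR R by (simp add: field_simps)
      have gk: "g (complex_of_real (1/c)) = G (y + k)" unfolding g_def by (subst k) simp
      have g0: "g 0 = G y" by (simp add: g_def scaleC.zero_left)
      show ?thesis
        using cauchy_first_order(2,3)[OF g gb small] 
        unfolding gk g0 n dk by (simp add: field_simps power2_eq_square)
    qed
    ultimately show ?thesis by blast
  qed
  then show "norm (line_deriv G y k) \<le> 8 * K / R * norm k"
    and "norm k \<le> R/4 \<Longrightarrow> norm (G (y + k) - G y) \<le> 8 * K / R * norm k"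
    and "norm k \<le> R/4 \<Longrightarrow> norm (G (y + k) - G y - line_deriv G y k) \<le> 128 * K / R\<^sup>2 * (norm k)\<^sup>2"
    by auto
qed


text \<open>The derivative in a fixed direction \<open>h\<close> is a locally uniform limit of difference
  quotients, hence again holomorphic along lines.\<close>

lemma line_holomorphic_on_line_deriv:
  fixes G :: "'a::complex_normed_vector \<Rightarrow> complex"
  assumes hol: "line_holomorphic_on G (ball x R)" and R: "R > 0"
    and bd: "\<And>y. y \<in> ball x R \<Longrightarrow> norm (G y) \<le> K"
  shows "line_holomorphic_on (\<lambda>y. line_deriv G y h) (ball x (R/2))"
  unfolding line_holomorphic_on_def
proof (intro allI)
  fix y k
  define S where "S = {s. y + s *\<^sub>C k \<in> ball x (R/2)}"
  have S: "open S" unfolding S_def by (rule open_line_vimage) simp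
  \<comment> \<open>The shift by \<open>N\<close> makes every step size usable from n = 0 on: N
    \<ge> 1 avoids division by zero, and N \<ge> 4 |h| / R keeps the shifted points in the ball of
    radius R, so each quotient \<open>q n\<close> is holomorphic on all of \<open>S\<close>.\<close>
  obtain N :: nat where N: "max 1 (norm h / (R/4)) \<le> real N" using real_arch_simple by blast
  define \<epsilon> where "\<epsilon> = (\<lambda>n. 1 / (real n + real N))"
  have \<epsilon>: "\<epsilon> n > 0" for n using N by (simp add: \<epsilon>_def)
  have \<epsilon>h: "norm (complex_of_real (\<epsilon> n) *\<^sub>C h) = \<epsilon> n * norm h" for n
    using \<epsilon>[of n] by (simp add: norm_scaleC)
  have small: "\<epsilon> n * norm h \<le> R/4" for n
  proof -
    have "norm h / (R/4) \<le> real n + real N" using N by simp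
    then show ?thesis using N R by (simp add: \<epsilon>_def field_simps)
  qed
  define q where "q = (\<lambda>n s. (G (y + s *\<^sub>C k + of_real (\<epsilon> n) *\<^sub>C h) - G (y + s *\<^sub>C k)) / of_real (\<epsilon> n))"
  have mem: "z + of_real (\<epsilon> n) *\<^sub>C h \<in> ball x R" "z \<in> ball x R" if z: "z \<in> ball x (R/2)" for z n
  proof -
    have "norm (z + of_real (\<epsilon> n) *\<^sub>C h - x) \<le> norm (z - x) + norm (complex_of_real (\<epsilon> n) *\<^sub>C h)"
      by (metis add_diff_eq add.commute diff_add_eq norm_triangle_ineq)
    moreover have "norm (z - x) < R/2" using z by (simp add: dist_norm norm_minus_commute)
    ultimately have "norm (z + of_real (\<epsilon> n) *\<^sub>C h - x) < R" using small[of n] \<epsilon>h[of n] R by linarith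
    then show "z + of_real (\<epsilon> n) *\<^sub>C h \<in> ball x R" by (simp add: dist_norm norm_minus_commute)
    show "z \<in> ball x R" using z R by auto
  qed
  have hol1: "(\<lambda>s. G (y + s *\<^sub>C k)) holomorphic_on S"
    by (rule holomorphic_on_subset[OF hol[unfolded line_holomorphic_on_def, rule_format]])
      (use mem in \<open>auto simp: S_def\<close>)
  have hol2: "(\<lambda>s. G (y + s *\<^sub>C k + of_real (\<epsilon> n) *\<^sub>C h)) holomorphic_on S" for n
  proof -
    have "(\<lambda>s. G ((y + of_real (\<epsilon> n) *\<^sub>C h) + s *\<^sub>C k)) holomorphic_on S"
    proof (rule holomorphic_on_subset[OF hol[unfolded line_holomorphic_on_def, rule_format]], rule subsetI)
      fix s assume "s \<in> S"
      then show "s \<in> {s. y + of_real (\<epsilon> n) *\<^sub>C h + s *\<^sub>C k \<in> ball x R}"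
        using mem(1)[of "y + s *\<^sub>C k" n] by (simp add: S_def add_ac)
    qed
    then show ?thesis by (simp add: add_ac)
  qed
  \<comment> \<open>A second-order remainder divided by the step leaves one factor
    \<open>\<epsilon> n\<close> and no dependence on \<open>s\<close>, hence uniform
    convergence.\<close>
  have bound: "norm (q n s - line_deriv G (y + s *\<^sub>C k) h) \<le> 128 * K / R\<^sup>2 * (norm h)\<^sup>2 * \<epsilon> n"
    if s: "s \<in> S" for n s
  proof -
    define z where "z = y + s *\<^sub>C k"
    have z: "z \<in> ball x (R/2)" using s by (simp add: S_def z_def)
    have "norm (G (z + of_real (\<epsilon> n) *\<^sub>C h) - G z - line_deriv G z (of_real (\<epsilon> n) *\<^sub>C h))
        \<le> 128 * K / R\<^sup>2 * (norm (complex_of_real (\<epsilon> n) *\<^sub>C h))\<^sup>2"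
      by (rule line_cauchy(3)[OF hol R bd z]) (use small \<epsilon>h in auto)
    also have "line_deriv G z (of_real (\<epsilon> n) *\<^sub>C h) = of_real (\<epsilon> n) * line_deriv G z h"
      by (rule line_deriv_scaleC[OF hol open_ball mem(2)[OF z]])
    finally have "norm (G (z + of_real (\<epsilon> n) *\<^sub>C h) - G z - of_real (\<epsilon> n) * line_deriv G z h) / \<epsilon> n
        \<le> 128 * K / R\<^sup>2 * (\<epsilon> n * norm h)\<^sup>2 / \<epsilon> n"
      unfolding \<epsilon>h using \<epsilon>[of n] by (intro divide_right_mono) auto
    also have "128 * K / R\<^sup>2 * (\<epsilon> n * norm h)\<^sup>2 / \<epsilon> n = 128 * K / R\<^sup>2 * (norm h)\<^sup>2 * \<epsilon> n"
      using \<epsilon>[of n] by (simp add: power2_eq_square)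
    also have "norm (G (z + of_real (\<epsilon> n) *\<^sub>C h) - G z - of_real (\<epsilon> n) * line_deriv G z h) / \<epsilon> n
        = norm ((G (z + of_real (\<epsilon> n) *\<^sub>C h) - G z - of_real (\<epsilon> n) * line_deriv G z h) / of_real (\<epsilon> n))"
      using \<epsilon>[of n] by (simp add: norm_divide)
    also have "(G (z + of_real (\<epsilon> n) *\<^sub>C h) - G z - of_real (\<epsilon> n) * line_deriv G z h) / of_real (\<epsilon> n)
        = q n s - line_deriv G z h"
      using \<epsilon>[of n] by (simp add: q_def z_def diff_divide_distrib)
    finally show ?thesis by (simp add: z_def)
  qed
  have lim: "(\<lambda>n. 128 * K / R\<^sup>2 * (norm h)\<^sup>2 * \<epsilon> n) \<longlonglongrightarrow> 0"
  proof -
    have "(\<lambda>n. 1 / real (n + N)) \<longlonglongrightarrow> 0"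
      by (rule LIMSEQ_ignore_initial_segment[OF lim_1_over_n])
    then have "\<epsilon> \<longlonglongrightarrow> 0" by (simp add: \<epsilon>_def)
    then show ?thesis by (rule tendsto_mult_right_zero)
  qed
  show "(\<lambda>s. line_deriv G (y + s *\<^sub>C k) h) holomorphic_on {s. y + s *\<^sub>C k \<in> ball x (R/2)}"
    unfolding S_def[symmetric]
  proof (rule holomorphic_uniform_sequence[OF S])
    show "q n holomorphic_on S" for n
      unfolding q_def using \<epsilon>[of n] by (intro holomorphic_intros hol1 hol2) auto
    fix s assume "s \<in> S"
    then obtain d where d: "d > 0" "cball s d \<subseteq> S" using S open_contains_cball by blast
    have "uniform_limit (cball s d) q (\<lambda>s. line_deriv G (y + s *\<^sub>C k) h) sequentially"
    proof (rule uniform_limitI)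
      fix e :: real assume "e > 0"
      with lim have "\<forall>\<^sub>F n in sequentially. 128 * K / R\<^sup>2 * (norm h)\<^sup>2 * \<epsilon> n < e"
        by (rule order_tendstoD(2))
      then show "\<forall>\<^sub>F n in sequentially. \<forall>w\<in>cball s d. dist (q n w) (line_deriv G (y + w *\<^sub>C k) h) < e"
        proof eventually_elim
        case (elim n)
        show ?case
        proof
          fix w assume "w \<in> cball s d"
          then have "w \<in> S" using d by blast
          from le_less_trans[OF bound[OF this] elim]
          show "dist (q n w) (line_deriv G (y + w *\<^sub>C k) h) < e" by (simp add: dist_norm)
        qed
      qed
    qed
    with d show "\<exists>d>0. cball s d \<subseteq> S \<and> uniform_limit (cball s d) q (\<lambda>s. line_deriv G (y + s *\<^sub>C k) h) sequentially"
      by blast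
  qed
qed

section \<open>From Frechet holomorphy to the second Frechet derivative\<close>

lemma banach_holomorphic_onD:
  assumes "banach_holomorphic_on F S" "open S" "y \<in> S"
  shows "(F has_derivative frechet_D F y) (at y)" "bounded_clinear (frechet_D F y)"
proof -
  obtain L where L: "bounded_clinear L" "(F has_derivative L) (at y)"
    using assms unfolding banach_holomorphic_on_def by (metis at_within_open)
  then have "L = frechet_D F y" by (intro frechet_derivative_at)
  with L show "(F has_derivative frechet_D F y) (at y)" "bounded_clinear (frechet_D F y)" by auto
qed

lemma banach_holomorphic_line_deriv:
  fixes f :: "'a::complex_normed_vector \<Rightarrow> complex"
  assumes f: "banach_holomorphic_on f S" "open S" and y: "y + s *\<^sub>C k \<in> S"
  shows "((\<lambda>s. f (y + s *\<^sub>C k)) has_field_derivative frechet_D f (y + s *\<^sub>C k) k) (at s)"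
proof -
  note D = banach_holomorphic_onD[OF f y]
  have "((\<lambda>s. y + s *\<^sub>C k) has_derivative (\<lambda>t. t *\<^sub>C k)) (at s)"
    by (auto intro!: derivative_eq_intros scaleC.bounded_linear_left bounded_linear_imp_has_derivative)
  from diff_chain_at[OF this D(1)]
  show ?thesis
    by (simp add: o_def has_field_derivative_def bounded_clinear_complexD[OF D(2)] mult.commute[of _ "frechet_D f _ _"])
qed

lemma banach_holomorphic_imp_line_holomorphic:
  fixes f :: "'a::complex_normed_vector \<Rightarrow> complex"
  assumes f: "banach_holomorphic_on f S" "open S"
  shows "line_holomorphic_on f S"
  unfolding line_holomorphic_on_def
  using banach_holomorphic_line_deriv[OF f] open_line_vimage[OF f(2)]
  by (subst holomorphic_on_open) blast+

lemma line_deriv_eq_frechet_D: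
  fixes f :: "'a::complex_normed_vector \<Rightarrow> complex"
  assumes f: "banach_holomorphic_on f S" "open S" and y: "y \<in> S"
  shows "line_deriv f y k = frechet_D f y k"
  using banach_holomorphic_line_deriv[OF f, of y 0 k] y by (intro line_deriv_eqI) simp

text \<open>The candidate \<open>B k h\<close> differentiates in direction \<open>k\<close> the
  derivative in direction \<open>h\<close>. Its remainder is at most C2 |h| |k|^2, and the factor
  |h| is what makes this an operator-norm estimate. The delicate point is additivity in
  \<open>k\<close>, since a line derivative is only homogeneous in its direction. Additivity in
  \<open>h\<close> comes from linearity of Df(y), and symmetry of \<open>B\<close> carries it over
  to \<open>k\<close>.\<close>

theorem frechet_D_differentiable:
  fixes f :: "'a::complex_normed_vector \<Rightarrow> complex"
  assumes f: "banach_holomorphic_on f S" "open S" and x: "x \<in> S"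
  shows "(\<lambda>y. Blinfun (frechet_D f y)) differentiable (at x)"
proof -
  have "isCont f x" using banach_holomorphic_onD(1)[OF f x] by (rule has_derivative_continuous)
  then obtain d1 where d1: "d1 > 0" "\<And>y. dist y x < d1 \<Longrightarrow> dist (f y) (f x) < 1"
    unfolding continuous_at_eps_delta by (meson zero_less_one)
  obtain d2 where d2: "d2 > 0" "ball x d2 \<subseteq> S" using f(2) x open_contains_ball by blast
  define R where "R = min d1 d2"
  define M where "M = norm (f x) + 1"
  have R: "R > 0" using d1 d2 by (simp add: R_def)
  have M: "M > 0" by (simp add: M_def add_nonneg_pos)
  have RS: "ball x R \<subseteq> S" using d2 by (auto simp: R_def)
  have bd: "norm (f y) \<le> M" if "y \<in> ball x R" for y
  proof -
    have "norm (f y - f x) < 1" using d1(2)[of y] that by (simp add: R_def dist_norm norm_minus_commute)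
    then show ?thesis unfolding M_def by (metis norm_triangle_sub add.commute add_le_cancel_left less_imp_le order_trans add_mono order_refl)
  qed
  have lh: "line_holomorphic_on f (ball x R)"
    by (rule line_holomorphic_on_subset[OF banach_holomorphic_imp_line_holomorphic[OF f] RS])
  define \<phi> where "\<phi> = (\<lambda>h y. line_deriv f y h)"
  have \<phi>_eq: "\<phi> h y = frechet_D f y h" if "y \<in> ball x R" for h y
    unfolding \<phi>_def using that RS by (intro line_deriv_eq_frechet_D[OF f]) auto
  have clin: "bounded_clinear (frechet_D f y)" if "y \<in> ball x R" for y
    using that RS by (intro banach_holomorphic_onD[OF f]) auto
  have half: "y \<in> ball x R" if "y \<in> ball x (R/2)" for y using that R by auto
  have \<phi>_bd: "norm (\<phi> h y) \<le> 8 * M / R * norm h" if "y \<in> ball x (R/2)" for h y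
    unfolding \<phi>_def by (rule line_cauchy(1)[OF lh R bd that])
  have \<phi>_lh: "line_holomorphic_on (\<phi> h) (ball x (R/2))" for h
    unfolding \<phi>_def by (rule line_holomorphic_on_line_deriv[OF lh R bd])
  have R2: "R/2 > 0" and x2: "x \<in> ball x (R/2)" and x4: "x \<in> ball x (R/2/2)" using R by auto
  define B where "B = (\<lambda>k h. line_deriv (\<phi> h) x k)"
  have B_has: "((\<lambda>s. \<phi> h (x + s *\<^sub>C k)) has_field_derivative B k h) (at 0)" for h k
    unfolding B_def by (rule line_has_deriv[OF \<phi>_lh open_ball x2])
  \<comment> \<open>Both constants come from \<open>line_cauchy\<close> for \<open>\<phi> h\<close>
    on the ball of radius R/2 with bound 8 M |h| / R: 128 = 8 * 8 * 2 and 4096 = 128 * 8 * 4. The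
    later restriction |k| \<le> R/8 is a quarter of R/2.\<close>
  define C1 where "C1 = 128 * M / R\<^sup>2"
  have B_bd: "norm (B k h) \<le> C1 * norm h * norm k" for k h
    using line_cauchy(1)[OF \<phi>_lh R2 \<phi>_bd x4, of h k]
    unfolding B_def C1_def by (simp add: field_simps power2_eq_square)
  define C2 where "C2 = 4096 * M / R^3"
  have C2: "C2 > 0" using M R by (simp add: C2_def)
  have B_est: "norm (\<phi> h (x + k) - \<phi> h x - B k h) \<le> C2 * norm h * (norm k)\<^sup>2" if "norm k \<le> R/8" for k h
    using line_cauchy(3)[OF \<phi>_lh R2 \<phi>_bd x4, of k h] that
    unfolding B_def C2_def by (simp add: field_simps power2_eq_square power3_eq_cube)
  have B_scale1: "B (c *\<^sub>C k) h = c * B k h" for c k h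
    unfolding B_def by (rule line_deriv_scaleC[OF \<phi>_lh open_ball x2])
  have near: "\<forall>\<^sub>F s in nhds 0. x + s *\<^sub>C k \<in> ball x R" for k
    using open_line_vimage[OF open_ball, of x k x R] R
    by (auto simp: eventually_nhds)
  have B_lin: "bounded_clinear (B k)" for k
    unfolding bounded_clinear_def
  proof (intro conjI allI)
    show sc: "B k (c *\<^sub>C h) = c *\<^sub>C B k h" for c h
    proof -
      have "((\<lambda>s. c * \<phi> h (x + s *\<^sub>C k)) has_field_derivative c * B k h) (at 0)"
        by (rule DERIV_cmult[OF B_has])
      then have "((\<lambda>s. \<phi> (c *\<^sub>C h) (x + s *\<^sub>C k)) has_field_derivative c * B k h) (at 0)"
        by (rule DERIV_cong_ev[OF refl _ refl, THEN iffD1, rotated])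
          (use near[of k] in eventually_elim, simp add: \<phi>_eq bounded_clinear_complexD[OF clin])
      then have "B k (c *\<^sub>C h) = c * B k h" unfolding B_def by (rule line_deriv_eqI)
      then show ?thesis by (simp add: scaleC_complex_def)
    qed
    show "bounded_linear (B k)"
    proof (rule bounded_linear_intro)
      fix h h' :: 'a and t :: real
      have "((\<lambda>s. \<phi> h (x + s *\<^sub>C k) + \<phi> h' (x + s *\<^sub>C k)) has_field_derivative B k h + B k h') (at 0)"
        by (rule DERIV_add[OF B_has B_has])
      then have "((\<lambda>s. \<phi> (h + h') (x + s *\<^sub>C k)) has_field_derivative B k h + B k h') (at 0)"
        by (rule DERIV_cong_ev[OF refl _ refl, THEN iffD1, rotated])
          (use near[of k] in eventually_elim, simp add: \<phi>_eq bounded_clinearD(1)[OF clin] linear_simps)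
      then show "B k (h + h') = B k h + B k h'" unfolding B_def by (rule line_deriv_eqI)
      show "B k (t *\<^sub>R h) = t *\<^sub>R B k h" unfolding scaleR_eq_scaleC by (rule sc)
      show "norm (B k h) \<le> norm h * (C1 * norm k)" using B_bd[of k h] by (simp add: mult_ac)
    qed
  qed
  text \<open>Both mixed derivatives are the leading term of the symmetric second difference
    \<open>f (x + k + h) - f (x + k) - f (x + h) + f x\<close>, so \<open>B\<close> is symmetric.\<close>
  have sym: "B k h = B h k" for k h
  proof -
    define Q where "Q = (\<lambda>k h. f (x + k + h) - f (x + k) - f (x + h) + f x)"
    have Q: "norm (Q k h - B k h) \<le> C2 * norm h * norm k * (norm h + norm k)"
      if k: "norm k \<le> R/8" and h: "norm h \<le> R/8" for k h
    proof -
      \<comment> \<open>\<open>\<psi>\<close> is the first-order Taylor remainder in direction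
        \<open>h\<close>. It is line-holomorphic and uniformly O(|h|^2), so its increment over
        \<open>k\<close> is O(|h|^2 |k|) by the Cauchy estimates.\<close>
      define \<psi> where "\<psi> = (\<lambda>y. f (y + h) - f y - \<phi> h y)"
      have h4: "norm h \<le> R/4" using h R by simp
      have \<psi>_bd: "norm (\<psi> y) \<le> 128 * M / R\<^sup>2 * (norm h)\<^sup>2" if "y \<in> ball x (R/2)" for y
        unfolding \<psi>_def \<phi>_def by (rule line_cauchy(3)[OF lh R bd that h4])
      have mem: "y + h \<in> ball x R" if "y \<in> ball x (R/2)" for y
      proof -
        have "norm (y + h - x) \<le> norm (y - x) + norm h"
          by (metis add_diff_eq add.commute diff_add_eq norm_triangle_ineq)
        moreover have "norm (y - x) < R/2" using that by (simp add: dist_norm norm_minus_commute)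
        ultimately have "norm (y + h - x) < R" using h4 R by linarith
        then show ?thesis by (simp add: dist_norm norm_minus_commute)
      qed
      have "line_holomorphic_on \<psi> (ball x (R/2))"
        unfolding line_holomorphic_on_def \<psi>_def
      proof (intro allI holomorphic_on_diff)
        fix y k
        have "(\<lambda>s. f ((y + h) + s *\<^sub>C k)) holomorphic_on {s. y + s *\<^sub>C k \<in> ball x (R/2)}"
        proof (rule holomorphic_on_subset[OF lh[unfolded line_holomorphic_on_def, rule_format]], rule subsetI)
          fix s assume "s \<in> {s. y + s *\<^sub>C k \<in> ball x (R/2)}"
          then show "s \<in> {s. y + h + s *\<^sub>C k \<in> ball x R}"
            using mem[of "y + s *\<^sub>C k"] by (simp add: add_ac)
        qed
        then show "(\<lambda>s. f (y + s *\<^sub>C k + h)) holomorphic_on {s. y + s *\<^sub>C k \<in> ball x (R/2)}"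
          by (simp add: add_ac)
        show "(\<lambda>s. f (y + s *\<^sub>C k)) holomorphic_on {s. y + s *\<^sub>C k \<in> ball x (R/2)}"
          by (rule holomorphic_on_subset[OF lh[unfolded line_holomorphic_on_def, rule_format]])
            (use half in auto)
        show "(\<lambda>s. \<phi> h (y + s *\<^sub>C k)) holomorphic_on {s. y + s *\<^sub>C k \<in> ball x (R/2)}"
          using \<phi>_lh unfolding line_holomorphic_on_def by blast
      qed
      from line_cauchy(2)[OF this R2 \<psi>_bd x4, of k] k
      have "norm (\<psi> (x + k) - \<psi> x) \<le> 8 * (128 * M / R\<^sup>2 * (norm h)\<^sup>2) / (R/2) * norm k"
        by simp
      also have "\<dots> = 1/2 * (C2 * (norm h)\<^sup>2 * norm k)"
        using R by (simp add: C2_def field_simps power2_eq_square power3_eq_cube)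
      also have "\<dots> \<le> C2 * (norm h)\<^sup>2 * norm k" using C2 by simp
      finally have "norm (\<psi> (x + k) - \<psi> x) \<le> C2 * (norm h)\<^sup>2 * norm k" .
      moreover have "norm (\<phi> h (x + k) - \<phi> h x - B k h) \<le> C2 * norm h * (norm k)\<^sup>2"
        by (rule B_est[OF k])
      moreover have "Q k h - B k h = (\<psi> (x + k) - \<psi> x) + (\<phi> h (x + k) - \<phi> h x - B k h)"
        by (simp add: Q_def \<psi>_def)
      ultimately have "norm (Q k h - B k h) \<le> C2 * (norm h)\<^sup>2 * norm k + C2 * norm h * (norm k)\<^sup>2"
        by (metis norm_triangle_mono)
      then show ?thesis by (simp add: power2_eq_square algebra_simps)
    qed
    have Qs: "Q k h = Q h k" for k h by (simp add: Q_def add_ac)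
    have sc: "B (of_real t *\<^sub>C k) (of_real t *\<^sub>C h) = of_real (t\<^sup>2) * B k h" for t k h
      unfolding B_scale1 bounded_clinear_complexD[OF B_lin] by (simp add: power2_eq_square)
    define E where "E = 2 * (C2 * norm h * norm k * (norm h + norm k))"
    \<comment> \<open>Under scaling by \<open>t\<close> the form \<open>B\<close> is quadratic and
      the error in \<open>Q\<close> is cubic. Dividing by t^2 leaves a bound that vanishes with
      \<open>t\<close>.\<close>
    have le: "norm (B k h - B h k) \<le> E * t" if t: "t > 0" "t * norm k \<le> R/8" "t * norm h \<le> R/8" for t
    proof -
      let ?k = "complex_of_real t *\<^sub>C k" and ?h = "complex_of_real t *\<^sub>C h"
      have n: "norm ?k = t * norm k" "norm ?h = t * norm h" using t by (simp_all add: norm_scaleC)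
      have "B ?k ?h - B ?h ?k = (Q ?h ?k - B ?h ?k) - (Q ?k ?h - B ?k ?h)" using Qs[of ?k ?h] by simp
      also have "norm \<dots> \<le> norm (Q ?h ?k - B ?h ?k) + norm (Q ?k ?h - B ?k ?h)"
        by (rule norm_triangle_ineq4)
      also have "\<dots> \<le> C2 * norm ?k * norm ?h * (norm ?k + norm ?h) + C2 * norm ?h * norm ?k * (norm ?h + norm ?k)"
        using t n by (intro add_mono Q) auto
      also have "\<dots> = t\<^sup>2 * (E * t)"
        unfolding n E_def by (simp add: power2_eq_square algebra_simps)
      also have "B ?k ?h - B ?h ?k = of_real (t\<^sup>2) * (B k h - B h k)"
        unfolding sc by (simp add: algebra_simps)
      finally have "t\<^sup>2 * norm (B k h - B h k) \<le> t\<^sup>2 * (E * t)" by (simp add: norm_mult norm_power)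
      then show ?thesis using t by simp
    qed
    have "norm (B k h - B h k) \<le> 0"
    proof (rule field_le_epsilon)
      fix e :: real assume e: "e > 0"
      define t where "t = min (e / (\<bar>E\<bar> + 1)) (R / (8 * (norm k + norm h + 1)))"
      have P: "norm k + norm h + 1 > 0" by (simp add: add_nonneg_pos)
      have t: "t > 0" using e R P by (simp add: t_def add_nonneg_pos)
      have "t * (norm k + norm h + 1) \<le> R / 8"
      proof -
        have "t \<le> R / (8 * (norm k + norm h + 1))" by (simp add: t_def)
        then show ?thesis using P by (simp add: pos_le_divide_eq mult_ac)
      qed
      moreover have "t * norm k \<le> t * (norm k + norm h + 1)" "t * norm h \<le> t * (norm k + norm h + 1)"
        using t by (auto intro!: mult_left_mono)
      ultimately have "norm (B k h - B h k) \<le> E * t" using t by (intro le) linarith+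
      also have "\<dots> \<le> (\<bar>E\<bar> + 1) * t" using t by (intro mult_right_mono) auto
      also have "\<dots> \<le> (\<bar>E\<bar> + 1) * (e / (\<bar>E\<bar> + 1))" by (intro mult_left_mono) (auto simp: t_def)
      also have "\<dots> = e" by (simp add: add_nonneg_pos field_simps)
      finally show "norm (B k h - B h k) \<le> 0 + e" by simp
    qed
    then show ?thesis by simp
  qed
  have app: "blinfun_apply (Blinfun (B k)) = B k" for k
    by (rule bounded_linear_Blinfun_apply[OF bounded_clinearD(1)[OF B_lin]])
  have "((\<lambda>y. Blinfun (frechet_D f y)) has_derivative (\<lambda>k. Blinfun (B k))) (at x)"
    unfolding has_derivative_at_alt
  proof (intro conjI allI impI)
    show "bounded_linear (\<lambda>k. Blinfun (B k))"
    proof (rule bounded_linear_intro)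
      fix k k' :: 'a and t :: real
      \<comment> \<open>Symmetry moves the sum into the second argument of \<open>B\<close>, where
        additivity is known.\<close>
      show "Blinfun (B (k + k')) = Blinfun (B k) + Blinfun (B k')"
        using bounded_clinearD(1)[OF B_lin]
        by (intro blinfun_eqI) (simp add: app blinfun.add_left sym[of _ "_::'a"] linear_simps)
      show "Blinfun (B (t *\<^sub>R k)) = t *\<^sub>R Blinfun (B k)"
        by (intro blinfun_eqI) (simp add: app blinfun.scaleR_left scaleR_eq_scaleC[of t k] B_scale1 scaleR_conv_of_real)
      show "norm (Blinfun (B k)) \<le> norm k * C1"
        using B_bd[of k] M by (intro norm_blinfun_bound) (auto simp: app C1_def mult_ac)
    qed
    fix e :: real assume e: "e > 0"
    define d where "d = min (R/8) (e / C2)"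
    have d: "d > 0" using e R C2 by (simp add: d_def)
    show "\<exists>d>0. \<forall>y. norm (y - x) < d \<longrightarrow>
        norm (Blinfun (frechet_D f y) - Blinfun (frechet_D f x) - Blinfun (B (y - x))) \<le> e * norm (y - x)"
    proof (intro exI[of _ d] conjI allI impI d)
      fix y assume y: "norm (y - x) < d"
      define k where "k = y - x"
      have k: "norm k < d" "y = x + k" using y by (simp_all add: k_def)
      have yR: "y \<in> ball x R" and xR: "x \<in> ball x R" using y R by (auto simp: d_def dist_norm norm_minus_commute)
      have app2: "blinfun_apply (Blinfun (frechet_D f z)) = frechet_D f z" if "z \<in> ball x R" for z
        by (rule bounded_linear_Blinfun_apply[OF bounded_clinearD(1)[OF clin[OF that]]])
      have "norm (Blinfun (frechet_D f y) - Blinfun (frechet_D f x) - Blinfun (B k)) \<le> e * norm k"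
      proof (rule norm_blinfun_bound)
        fix h
        have "norm (\<phi> h (x + k) - \<phi> h x - B k h) \<le> C2 * norm h * (norm k)\<^sup>2"
          using k by (intro B_est) (auto simp: d_def)
        also have "\<dots> = (C2 * norm k) * norm k * norm h" by (simp add: power2_eq_square)
        also have "\<dots> \<le> e * norm k * norm h"
          using k C2 by (intro mult_right_mono) (auto simp: d_def field_simps)
        finally show "norm (blinfun_apply (Blinfun (frechet_D f y) - Blinfun (frechet_D f x) - Blinfun (B k)) h)
            \<le> e * norm k * norm h"
          using yR xR k by (simp add: blinfun.diff_left app app2 \<phi>_eq)
      qed (use e in auto)
      then show "norm (Blinfun (frechet_D f y) - Blinfun (frechet_D f x) - Blinfun (B (y - x))) \<le> e * norm (y - x)"
        by (simp add: k_def)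
    qed
  qed
  then show ?thesis by (auto simp: differentiable_def)
qed

subsection \<open>Support functionals\<close>

definition sublinear :: "('a::real_vector \<Rightarrow> real) \<Rightarrow> bool" where
  "sublinear p \<longleftrightarrow> (\<forall>x y. p (x + y) \<le> p x + p y) \<and> (\<forall>t x. 0 \<le> t \<longrightarrow> p (t *\<^sub>R x) = t * p x)"

lemma sublinearD:
  assumes "sublinear p"
  shows "p (x + y) \<le> p x + p y" "0 \<le> t \<Longrightarrow> p (t *\<^sub>R x) = t * p x" "p 0 = 0" "- p (- x) \<le> p x"
proof -
  show 1: "p (x + y) \<le> p x + p y" "0 \<le> t \<Longrightarrow> p (t *\<^sub>R x) = t * p x" for x y t
    using assms unfolding sublinear_def by auto
  show 0: "p 0 = 0" using 1(2)[of 0 0] by simp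
  show "- p (- x) \<le> p x" using 1(1)[of x "- x"] 0 by simp
qed

text \<open>Lowers \<open>p\<close> by pushing along the ray through \<open>y\<close>; it is a fixed point exactly when
  \<open>p\<close> is additive in direction \<open>y\<close>.\<close>

definition ray_inf :: "('a::real_vector \<Rightarrow> real) \<Rightarrow> 'a \<Rightarrow> 'a \<Rightarrow> real" where
  "ray_inf p y x = (INF t\<in>{0..}. p (x + t *\<^sub>R y) - t * p y)"

text \<open>By subadditivity the values along the ray stay above \<open>- p (- x)\<close>, so the
  infimum in \<open>ray_inf\<close> is a genuine one and these two bounds characterise it.\<close>

lemma
  assumes p: "sublinear p"
  shows ray_inf_lower: "0 \<le> t \<Longrightarrow> ray_inf p y x \<le> p (x + t *\<^sub>R y) - t * p y"
    and ray_inf_greatest: "(\<And>t. 0 \<le> t \<Longrightarrow> m \<le> p (x + t *\<^sub>R y) - t * p y) \<Longrightarrow> m \<le> ray_inf p y x"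
proof -
  have "- p (- x) \<le> p (x + t *\<^sub>R y) - t * p y" if "0 \<le> t" for t
    using sublinearD(1)[OF p, of "x + t *\<^sub>R y" "- x"] sublinearD(2)[OF p that, of y] by simp
  then have "bdd_below ((\<lambda>t. p (x + t *\<^sub>R y) - t * p y) ` {0..})"
    by (intro bdd_belowI[of _ "- p (- x)"]) auto
  then show "0 \<le> t \<Longrightarrow> ray_inf p y x \<le> p (x + t *\<^sub>R y) - t * p y"
    unfolding ray_inf_def by (intro cINF_lower) auto
  show "(\<And>t. 0 \<le> t \<Longrightarrow> m \<le> p (x + t *\<^sub>R y) - t * p y) \<Longrightarrow> m \<le> ray_inf p y x"
    unfolding ray_inf_def by (intro cINF_greatest) auto
qed

text \<open>For subadditivity the ray parameters of the two points are added; scaling by t > 0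
  reparametrises the ray. The inequality obtained for \<open>t\<close> gives its own converse when
  applied to 1/t.\<close>

lemma sublinear_ray_inf:
  assumes p: "sublinear p"
  shows "sublinear (ray_inf p y)"
  unfolding sublinear_def
proof (intro conjI allI impI)
  fix x z
  have "ray_inf p y (x + z) - (p (x + s *\<^sub>R y) - s * p y) \<le> ray_inf p y z" if s: "0 \<le> s" for s
  proof (rule ray_inf_greatest[OF p])
    fix t :: real assume t: "0 \<le> t"
    have "ray_inf p y (x + z) \<le> p (x + z + (s + t) *\<^sub>R y) - (s + t) * p y"
      using s t by (intro ray_inf_lower[OF p]) auto
    also have "x + z + (s + t) *\<^sub>R y = (x + s *\<^sub>R y) + (z + t *\<^sub>R y)" by (simp add: algebra_simps)
    also have "p \<dots> \<le> p (x + s *\<^sub>R y) + p (z + t *\<^sub>R y)" by (rule sublinearD(1)[OF p])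
    finally show "ray_inf p y (x + z) - (p (x + s *\<^sub>R y) - s * p y) \<le> p (z + t *\<^sub>R y) - t * p y"
      by (simp add: algebra_simps)
  qed
  then have "ray_inf p y (x + z) - ray_inf p y z \<le> ray_inf p y x"
    by (intro ray_inf_greatest[OF p]) (simp add: algebra_simps)
  then show "ray_inf p y (x + z) \<le> ray_inf p y x + ray_inf p y z" by simp
next
  fix t :: real and x :: 'a
  have le: "ray_inf p y (t *\<^sub>R x) \<le> t * ray_inf p y x" if t: "0 < t" for t x
  proof -
    have "ray_inf p y (t *\<^sub>R x) / t \<le> ray_inf p y x"
    proof (rule ray_inf_greatest[OF p])
      fix s :: real assume s: "0 \<le> s"
      have "ray_inf p y (t *\<^sub>R x) \<le> p (t *\<^sub>R x + (t * s) *\<^sub>R y) - (t * s) * p y"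
        using s t by (intro ray_inf_lower[OF p]) auto
      also have "t *\<^sub>R x + (t * s) *\<^sub>R y = t *\<^sub>R (x + s *\<^sub>R y)" by (simp add: algebra_simps)
      also have "p \<dots> = t * p (x + s *\<^sub>R y)" using t by (intro sublinearD(2)[OF p]) auto
      finally show "ray_inf p y (t *\<^sub>R x) / t \<le> p (x + s *\<^sub>R y) - s * p y"
        using t by (simp add: field_simps)
    qed
    then show ?thesis using t by (simp add: field_simps)
  qed
  assume "0 \<le> t"
  show "ray_inf p y (t *\<^sub>R x) = t * ray_inf p y x"
  proof (cases "t = 0")
    case True
    have "0 \<le> ray_inf p y 0" using sublinearD(2)[OF p] by (intro ray_inf_greatest[OF p]) simp
    moreover have "ray_inf p y 0 \<le> 0" using ray_inf_lower[OF p, of 0 y 0] sublinearD(3)[OF p] by simp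
    ultimately show ?thesis using True by simp
  next
    case False
    with \<open>0 \<le> t\<close> have t: "0 < t" by simp
    have "ray_inf p y ((1/t) *\<^sub>R t *\<^sub>R x) \<le> (1/t) * ray_inf p y (t *\<^sub>R x)" using t by (intro le) simp
    then have "t * ray_inf p y x \<le> ray_inf p y (t *\<^sub>R x)" using t by (simp add: field_simps)
    with le[OF t, of x] show ?thesis by simp
  qed
qed

text \<open>Zorn's lemma for the reversed order, with the pointwise infimum as bound of a chain. It
  is finite because p \<ge> - p0(- x) for every member, and subadditive because two members p, q of
  a chain can be replaced by the smaller one.\<close>

lemma minimal_sublinear_exists:
  fixes p0 :: "'a::real_vector \<Rightarrow> real"
  assumes p0: "sublinear p0"
  obtains p where "sublinear p" "p \<le> p0" "\<And>q. sublinear q \<Longrightarrow> q \<le> p \<Longrightarrow> q = p"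
proof -
  define A where "A = {p. sublinear p \<and> p \<le> p0}"
  have "\<exists>m\<in>A. \<forall>a\<in>A. m \<ge> a \<longrightarrow> a = m"
  proof (rule predicate_Zorn)
    show "partial_order_on A (relation_of (\<ge>) A)"
      by (auto simp: partial_order_on_def preorder_on_def refl_on_def trans_def antisym_def relation_of_def)
    fix C assume C: "C \<in> Chains (relation_of (\<ge>) A)"
    then have CA: "C \<subseteq> A" and ch: "\<And>p q. p \<in> C \<Longrightarrow> q \<in> C \<Longrightarrow> p \<le> q \<or> q \<le> p"
      unfolding Chains_def relation_of_def by auto
    show "\<exists>u\<in>A. \<forall>a\<in>C. a \<ge> u"
    proof (cases "C = {}")
      case True
      then show ?thesis using p0 by (auto simp: A_def)
    next
      case ne: False
      have sub: "sublinear p" if "p \<in> C" for p using that CA by (auto simp: A_def)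
      have bdd: "bdd_below ((\<lambda>p. p x) ` C)" for x
      proof (rule bdd_belowI2[of _ "- p0 (- x)"])
        fix p assume p: "p \<in> C"
        then have "p (- x) \<le> p0 (- x)" using CA by (auto simp: A_def le_fun_def)
        with sublinearD(4)[OF sub[OF p], of x] show "- p0 (- x) \<le> p x" by simp
      qed
      define u where "u = (\<lambda>x. INF p\<in>C. p x)"
      have low: "u x \<le> p x" if "p \<in> C" for p x unfolding u_def by (rule cINF_lower[OF bdd that])
      have great: "m \<le> u x" if "\<And>p. p \<in> C \<Longrightarrow> m \<le> p x" for m x
        unfolding u_def by (rule cINF_greatest[OF ne that])
      have "sublinear u"
        unfolding sublinear_def
      proof (intro conjI allI impI)
        fix x y
        have "u (x + y) - u y \<le> u x"
        proof (rule great)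
          fix p assume p: "p \<in> C"
          have "u (x + y) - p x \<le> u y"
          proof (rule great)
            fix q assume q: "q \<in> C"
            obtain w where w: "w \<in> C" "w \<le> p" "w \<le> q" using ch[OF p q] p q by auto
            have "u (x + y) \<le> w x + w y"
              using low[OF w(1), of "x + y"] sublinearD(1)[OF sub[OF w(1)], of x y] by simp
            also have "\<dots> \<le> p x + q y" using w by (auto simp: le_fun_def add_mono)
            finally show "u (x + y) - p x \<le> q y" by simp
          qed
          then show "u (x + y) - u y \<le> p x" by simp
        qed
        then show "u (x + y) \<le> u x + u y" by simp
      next
        fix t :: real and x :: 'a
        assume t0: "0 \<le> t"
        have le: "u (t *\<^sub>R x) \<le> t * u x" if t: "0 < t" for t x
        proof -
          have "u (t *\<^sub>R x) / t \<le> u x"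
          proof (rule great)
            fix p assume p: "p \<in> C"
            show "u (t *\<^sub>R x) / t \<le> p x"
              using low[OF p, of "t *\<^sub>R x"] sublinearD(2)[OF sub[OF p], of t x] t by (simp add: field_simps)
          qed
          then show ?thesis using t by (simp add: field_simps)
        qed
        show "u (t *\<^sub>R x) = t * u x"
        proof (cases "t = 0")
          case True
          have "u 0 = 0"
            unfolding u_def using ne sub by (simp add: sublinearD(3) cong: INF_cong)
          then show ?thesis using True by simp
        next
          case False
          with t0 have t: "0 < t" by simp
          have "u ((1/t) *\<^sub>R t *\<^sub>R x) \<le> (1/t) * u (t *\<^sub>R x)" using t by (intro le) simp
          then have "t * u x \<le> u (t *\<^sub>R x)" using t by (simp add: field_simps)
          with le[OF t, of x] show ?thesis by simp
        qed
      qed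
      moreover have "u \<le> p0"
      proof -
        obtain p where "p \<in> C" using ne by auto
        then show ?thesis using low[of p] CA by (auto simp: A_def le_fun_def intro: order_trans)
      qed
      ultimately show ?thesis using low by (auto simp: A_def le_fun_def)
    qed
  qed
  then obtain p where "p \<in> A" "\<And>q. q \<in> A \<Longrightarrow> q \<le> p \<Longrightarrow> q = p" by blast
  then show thesis
    by (intro that[of p]) (auto simp: A_def intro: order_trans)
qed

text \<open>Minimality forces \<open>ray_inf p y = p\<close> for every \<open>y\<close>, and the ray
  parameter 1 then gives the reverse of subadditivity.\<close>

lemma minimal_sublinear_linear:
  assumes p: "sublinear p" and min: "\<And>q. sublinear q \<Longrightarrow> q \<le> p \<Longrightarrow> q = p"
  shows "linear p"
proof -
  have "ray_inf p y = p" for y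
    using ray_inf_lower[OF p, of 0 y] by (intro min sublinear_ray_inf p) (simp add: le_fun_def)
  then have "p x \<le> p (x + y) - p y" for x y
    using ray_inf_lower[OF p, of 1 y x] by simp
  then have add: "p (x + y) = p x + p y" for x y
    using sublinearD(1)[OF p, of x y] by (smt (verit))
  have neg: "p (- x) = - p x" for x using add[of x "- x"] sublinearD(3)[OF p] by simp
  have "p (t *\<^sub>R x) = t * p x" for t x
  proof (cases "0 \<le> t")
    case True then show ?thesis by (rule sublinearD(2)[OF p])
  next
    case False
    then have "p ((- t) *\<^sub>R x) = (- t) * p x" by (intro sublinearD(2)[OF p]) simp
    then show ?thesis using neg[of "t *\<^sub>R x"] by simp
  qed
  with add show ?thesis by (intro linearI) auto
qed

text \<open>Minimising below \<open>ray_inf norm x\<close> instead of \<open>norm\<close> builds in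
  attainment at \<open>x\<close>: ray parameter 1 at the point \<open>- x\<close> gives p(- x) \<le>
  - |x|. No extension from a subspace is involved.\<close>

lemma real_support_functional:
  fixes x :: "'a::real_normed_vector"
  obtains p where "linear p" "\<And>y. p y \<le> norm y" "p x = norm x"
proof -
  have n: "sublinear (norm :: 'a \<Rightarrow> real)"
    by (auto simp: sublinear_def norm_triangle_ineq)
  obtain p where p: "sublinear p" "p \<le> ray_inf norm x" "\<And>q. sublinear q \<Longrightarrow> q \<le> p \<Longrightarrow> q = p"
    using minimal_sublinear_exists[OF sublinear_ray_inf[OF n]] by blast
  have lin: "linear p" by (rule minimal_sublinear_linear[OF p(1,3)])
  have le: "p y \<le> norm y" for y
    using p(2) ray_inf_lower[OF n, of 0 x y] by (auto simp: le_fun_def intro: order_trans)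
  have "p (- x) \<le> - norm x"
    using p(2) ray_inf_lower[OF n, of 1 x "- x"] by (auto simp: le_fun_def intro: order_trans)
  then have "p x = norm x" using linear_neg[OF lin, of x] le[of x] by simp
  with lin le show thesis by (rule that)
qed

text \<open>A complex functional is recovered from its real part by Im l(y) = - Re l(iy). Since Re
  l(x) is already |x|, the bound |l(x)| \<le> |x| leaves no room for an imaginary part.\<close>

lemma support_functional_exists:
  fixes x :: "'a::complex_normed_vector"
  assumes x: "x \<noteq> 0"
  obtains l where "l \<in> support_functionals x"
proof -
  obtain p where p: "linear p" "\<And>y. p y \<le> norm y" "p x = norm x"
    using real_support_functional by blast
  define l where "l = (\<lambda>y. Complex (p y) (- p (\<i> *\<^sub>C y)))"
  have pC: "p (c *\<^sub>C y) = Re c * p y + Im c * p (\<i> *\<^sub>C y)" for c y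
  proof -
    have "c *\<^sub>C y = Re c *\<^sub>R y + Im c *\<^sub>R \<i> *\<^sub>C y"
      by (subst complex_eq[of c])
        (simp add: scaleC_add_left scaleR_eq_scaleC scaleC_scaleC mult.commute)
    then show ?thesis using p(1) by (simp add: linear_add linear_cmul)
  qed
  have lC: "l (c *\<^sub>C y) = c * l y" for c y
    using pC[of c y] pC[of "\<i> * c" y] by (simp add: l_def complex_eq_iff scaleC_scaleC)
  have ladd: "l (y + z) = l y + l z" for y z
    using p(1) by (simp add: l_def complex_eq_iff scaleC_add_right linear_add)
  have lbd: "norm (l y) \<le> norm y" for y
  proof -
    \<comment> \<open>This unimodular factor turns \<open>l y\<close> into a nonnegative real
      number, so the bound on the real part \<open>p\<close> bounds the modulus.\<close>
    define c where "c = cis (- Arg (l y))"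
    have "c * l y = of_real (norm (l y))"
      using rcis_cmod_Arg[of "l y"] unfolding c_def rcis_def
      by (metis add.right_inverse cis_mult cis_zero mult.commute mult.left_commute mult.right_neutral)
    then have "norm (l y) = Re (l (c *\<^sub>C y))" by (simp add: lC)
    also have "\<dots> = p (c *\<^sub>C y)" by (simp add: l_def)
    also have "\<dots> \<le> norm (c *\<^sub>C y)" by (rule p)
    also have "\<dots> = norm y" by (simp add: norm_scaleC c_def)
    finally show ?thesis .
  qed
  have blin: "bounded_linear l"
    by (rule bounded_linear_intro[where K = 1])
      (simp_all add: ladd lC scaleR_eq_scaleC lbd scaleC_complex_def)
  then have "bounded_clinear l" unfolding bounded_clinear_def by (simp add: lC scaleC_complex_def)
  moreover have lx: "l x = of_real (norm x)"
  proof -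
    have "Re (l x) = norm x" by (simp add: l_def p)
    moreover have "(Re (l x))\<^sup>2 + (Im (l x))\<^sup>2 \<le> (norm x)\<^sup>2"
      using power_mono[OF lbd[of x] norm_ge_zero, of 2] by (simp add: cmod_power2)
    ultimately show ?thesis by (simp add: complex_eq_iff)
  qed
  moreover have "onorm l = 1"
  proof (rule antisym)
    show "onorm l \<le> 1" by (rule onorm_bound) (use lbd in auto)
    have "norm (l x) \<le> onorm l * norm x" by (rule onorm[OF blin])
    then show "1 \<le> onorm l" using x by (simp add: lx)
  qed
  ultimately show thesis by (intro that[of l]) (simp add: support_functionals_def)
qed

subsection \<open>Convex functions on a disc\<close>

lemma has_vector_derivative_mult_cis:
  "((\<lambda>t. c * cis t) has_vector_derivative \<i> * (c * cis t)) (at t)"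
proof -
  have "(cis has_vector_derivative \<i> * cis t) (at t)"
    unfolding has_vector_derivative_def by (auto intro!: derivative_eq_intros)
  then have "((\<lambda>t. c * cis t) has_vector_derivative c * (\<i> * cis t)) (at t)"
    by (rule has_vector_derivative_mult_right)
  then show ?thesis by (simp add: mult.left_commute)
qed

text \<open>The angle \<open>\<psi>\<close> of the tangent to the image of the circle increases by exactly \<open>2 * pi\<close> over
  one turn, so the signed distance to the tangent line at parameter \<open>s\<close> first increases and
  then decreases back to \<open>0\<close>.\<close>

lemma convex_curve_tangent:
  fixes g :: "complex \<Rightarrow> complex"
  assumes hol: "g holomorphic_on ball 0 r" and \<rho>: "0 < \<rho>" "\<rho> < r"
    and nz: "\<And>z. z \<in> ball 0 r \<Longrightarrow> deriv g z \<noteq> 0"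
    and pos: "\<And>z. z \<in> ball 0 r \<Longrightarrow> Re (1 + z * deriv (deriv g) z / deriv g z) > 0"
    and w: "norm w = \<rho>"
  obtains c where "\<And>z. norm z = \<rho> \<Longrightarrow> z \<noteq> w \<Longrightarrow> Re (c * (g w - g z)) > 0"
proof -
  have hol': "deriv g holomorphic_on ball 0 r" by (rule holomorphic_deriv[OF hol]) simp
  have "0 \<in> ball (0::complex) r" using \<rho> by simp
  then obtain L0 where L0: "L0 holomorphic_on ball 0 r" "\<And>z. z \<in> ball 0 r \<Longrightarrow> deriv g z = exp (L0 z)"
    using holomorphic_logarithm_exists[OF convex_ball open_ball hol' nz] by metis
  have L0': "(L0 has_field_derivative deriv (deriv g) z / deriv g z) (at z)" if z: "z \<in> ball 0 r" for z
  proof -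
    have d: "(L0 has_field_derivative deriv L0 z) (at z)"
      by (rule holomorphic_derivI[OF L0(1) open_ball z])
    have "((\<lambda>z. exp (L0 z)) has_field_derivative exp (L0 z) * deriv L0 z) (at z)"
      by (rule DERIV_chain2[OF DERIV_exp d])
    then have "(deriv g has_field_derivative exp (L0 z) * deriv L0 z) (at z)"
      by (rule has_field_derivative_transform_within_open[where S = "ball 0 r"]) (use z L0(2) in auto)
    then have "deriv (deriv g) z = deriv g z * deriv L0 z"
      using DERIV_imp_deriv L0(2)[OF z] by metis
    then show ?thesis using d nz[OF z] by simp
  qed
  define \<gamma> where "\<gamma> = (\<lambda>t. complex_of_real \<rho> * cis t)"
  have \<gamma>: "\<gamma> t \<in> ball 0 r" for t using \<rho> by (simp add: \<gamma>_def norm_mult)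
  have \<gamma>': "(\<gamma> has_vector_derivative \<i> * \<gamma> t) (at t)" for t
    unfolding \<gamma>_def by (rule has_vector_derivative_mult_cis)
  \<comment> \<open>The velocity of \<open>g (\<gamma> t)\<close> is \<i> *
    \<open>\<gamma> t\<close> * exp(\<open>L0 (\<gamma> t)\<close>), so \<open>\<psi>\<close> is a
    continuous branch of its argument minus pi/2. Because \<open>L0\<close> is single-valued on the
    disc, one turn adds exactly 2 pi.\<close>
  define \<psi> where "\<psi> = (\<lambda>t. t + Im (L0 (\<gamma> t)))"
  have "((\<lambda>t. L0 (\<gamma> t)) has_vector_derivative (\<i> * \<gamma> t) * (deriv (deriv g) (\<gamma> t) / deriv g (\<gamma> t))) (at t)" for t
    using field_vector_diff_chain_at[OF \<gamma>' L0'[OF \<gamma>]] by (simp add: o_def)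
  then have "((\<lambda>t. Im (L0 (\<gamma> t))) has_vector_derivative
      Im ((\<i> * \<gamma> t) * (deriv (deriv g) (\<gamma> t) / deriv g (\<gamma> t)))) (at t)" for t
    by (rule bounded_linear.has_vector_derivative[OF bounded_linear_Im])
  then have \<psi>': "(\<psi> has_real_derivative Re (1 + \<gamma> t * deriv (deriv g) (\<gamma> t) / deriv g (\<gamma> t))) (at t)" for t
    unfolding \<psi>_def has_real_derivative_iff_has_vector_derivative
    by (auto intro!: derivative_eq_intros simp: mult.assoc simp flip: times_divide_eq_right)
  have \<psi>_mono: "\<psi> a < \<psi> b" if "a < b" for a b
    by (rule DERIV_pos_imp_increasing[OF that]) (use \<psi>' pos[OF \<gamma>] in blast)
  have \<psi>_per: "\<psi> (t + 2 * pi) = \<psi> t + 2 * pi" for t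
    by (simp add: \<psi>_def \<gamma>_def cis.ctr complex_eq_iff)
  obtain s where s: "w = \<gamma> s"
    using w unfolding \<gamma>_def by (metis rcis_cmod_Arg rcis_def)
  define K where "K = (\<lambda>t. Re (cis (- \<psi> s) * (g w - g (\<gamma> t))))"
  have K': "(K has_real_derivative (\<rho> * exp (Re (L0 (\<gamma> t))) * sin (\<psi> t - \<psi> s))) (at t)" for t
  proof -
    have "(g has_field_derivative exp (L0 (\<gamma> t))) (at (\<gamma> t))"
      using holomorphic_derivI[OF hol open_ball \<gamma>] L0(2)[OF \<gamma>] by simp
    from field_vector_diff_chain_at[OF \<gamma>' this]
    have "((\<lambda>t. g (\<gamma> t)) has_vector_derivative \<i> * \<gamma> t * exp (L0 (\<gamma> t))) (at t)"
      by (simp add: o_def)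
    then have "((\<lambda>t. cis (- \<psi> s) * (g w - g (\<gamma> t))) has_vector_derivative
        cis (- \<psi> s) * (0 - \<i> * \<gamma> t * exp (L0 (\<gamma> t)))) (at t)"
      by (intro has_vector_derivative_mult_right has_vector_derivative_diff has_vector_derivative_const)
    then have *: "(K has_vector_derivative Re (cis (- \<psi> s) * (0 - \<i> * \<gamma> t * exp (L0 (\<gamma> t))))) (at t)"
      unfolding K_def by (rule bounded_linear.has_vector_derivative[OF bounded_linear_Re])
    have "exp (L0 (\<gamma> t)) = of_real (exp (Re (L0 (\<gamma> t)))) * cis (Im (L0 (\<gamma> t)))"
      by (simp add: exp_eq_polar exp_of_real)
    then have "cis (- \<psi> s) * (0 - \<i> * \<gamma> t * exp (L0 (\<gamma> t)))
        = - \<i> * of_real (\<rho> * exp (Re (L0 (\<gamma> t)))) * (cis (- \<psi> s) * (cis t * cis (Im (L0 (\<gamma> t)))))"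
      by (simp add: \<gamma>_def)
    also have "cis (- \<psi> s) * (cis t * cis (Im (L0 (\<gamma> t)))) = cis (\<psi> t - \<psi> s)"
      by (simp add: cis_mult \<psi>_def algebra_simps)
    finally have eq: "cis (- \<psi> s) * (0 - \<i> * \<gamma> t * exp (L0 (\<gamma> t)))
        = - \<i> * of_real (\<rho> * exp (Re (L0 (\<gamma> t)))) * cis (\<psi> t - \<psi> s)" .
    have "Re (cis (- \<psi> s) * (0 - \<i> * \<gamma> t * exp (L0 (\<gamma> t))))
        = \<rho> * exp (Re (L0 (\<gamma> t))) * sin (\<psi> t - \<psi> s)"
      unfolding eq by (simp del: of_real_mult)
    then show ?thesis
      using * by (simp only: has_real_derivative_iff_has_vector_derivative)
  qed
  have "isCont \<psi> t" for t using \<psi>' by (rule DERIV_isCont)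
  \<comment> \<open>At \<open>m\<close> the tangent is antiparallel to the one at \<open>s\<close>;
    there the sine in \<open>K'\<close> changes from positive to negative.\<close>
  then obtain m where m: "s \<le> m" "m \<le> s + 2 * pi" "\<psi> m = \<psi> s + pi"
    using IVT[of \<psi> s "\<psi> s + pi" "s + 2 * pi"] \<psi>_per[of s] by auto
  have up: "K a < K b" if "s \<le> a" "a < b" "b \<le> m" for a b
  proof (rule DERIV_pos_imp_increasing_open[OF that(2)])
    fix t assume t: "a < t" "t < b"
    then have "\<psi> s < \<psi> t" "\<psi> t < \<psi> m" using that by (auto intro!: \<psi>_mono)
    then have "sin (\<psi> t - \<psi> s) > 0" using m(3) by (intro sin_gt_zero) linarith+
    then show "\<exists>y. (K has_real_derivative y) (at t) \<and> 0 < y" using K' \<rho> by (metis exp_gt_zero mult_pos_pos)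
  qed (use K' DERIV_isCont in \<open>blast intro: continuous_at_imp_continuous_on\<close>)
  have down: "K b < K a" if "m \<le> a" "a < b" "b \<le> s + 2 * pi" for a b
  proof (rule DERIV_neg_imp_decreasing_open[OF that(2)])
    fix t assume t: "a < t" "t < b"
    then have "\<psi> m < \<psi> t" "\<psi> t < \<psi> (s + 2 * pi)" using that by (auto intro!: \<psi>_mono)
    then have "sin (\<psi> t - \<psi> s) < 0" using m(3) \<psi>_per[of s] by (intro sin_lt_zero) linarith+
    then show "\<exists>y. (K has_real_derivative y) (at t) \<and> y < 0" using K' \<rho> by (metis exp_gt_zero mult_pos_pos mult_pos_neg)
  qed (use K' DERIV_isCont in \<open>blast intro: continuous_at_imp_continuous_on\<close>)
  have K0: "K s = 0" "K (s + 2 * pi) = 0"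
    using s by (simp_all add: K_def \<gamma>_def cis.ctr)
  show thesis
  proof (rule that[of "cis (- \<psi> s)"])
    fix z assume z: "norm z = \<rho>" "z \<noteq> w"
    define a where "a = Arg (z / w)"
    have w0: "w \<noteq> 0" using w \<rho> by auto
    have zw: "z = w * cis a" using z w w0 \<rho> rcis_cmod_Arg[of "z / w"]
      by (simp add: a_def rcis_def norm_divide)
    have "-pi < a" "a \<le> pi" using Arg_bounded[of "z / w"] by (auto simp: a_def)
    have "a \<noteq> 0" using z(2) zw by (metis cis_zero mult.right_neutral)
    define b where "b = (if a > 0 then a else a + 2 * pi)"
    have b: "0 < b" "b < 2 * pi" using \<open>-pi < a\<close> \<open>a \<le> pi\<close> \<open>a \<noteq> 0\<close> pi_gt_zero by (auto simp: b_def)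
    have zb: "z = \<gamma> (s + b)"
    proof -
      have "cis (a + 2 * pi) = cis a" by (simp add: cis.ctr)
      then have "cis b = cis a" unfolding b_def by simp
      moreover have "cis (s + b) = cis s * cis b" by (simp only: cis_mult)
      ultimately show ?thesis unfolding zw s \<gamma>_def by (simp only: mult.assoc)
    qed
    have "K (s + b) > 0"
    proof (cases "s + b \<le> m")
      case True
      then show ?thesis using up[of s "s + b"] b K0 by simp
    next
      case False
      then show ?thesis using down[of "s + b" "s + 2 * pi"] b K0 by simp
    qed
    then show "Re (cis (- \<psi> s) * (g w - g z)) > 0" by (simp add: K_def zb)
  qed
qed

text \<open>By the open mapping theorem some point e/2 to the left of \<open>h z\<close> is still a
  value of \<open>h\<close>, and its real part is nonnegative too.\<close>

lemma Re_pos_if_Re_nonneg: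
  fixes h :: "complex \<Rightarrow> complex"
  assumes hol: "h holomorphic_on S" and S: "open S" "connected S"
    and nc: "\<not> h constant_on S"
    and le: "\<And>z. z \<in> S \<Longrightarrow> Re (h z) \<ge> 0" and z: "z \<in> S"
  shows "Re (h z) > 0"
proof -
  have "open (h ` S)" by (rule open_mapping_thm[OF hol S S(1) order_refl nc])
  then obtain e where e: "e > 0" "ball (h z) e \<subseteq> h ` S"
    using z open_contains_ball by blast
  have "h z - of_real (e/2) \<in> ball (h z) e" using e by (simp add: dist_norm)
  then obtain z' where "z' \<in> S" "h z - of_real (e/2) = h z'" using e by blast
  then have "Re (h z) - e/2 \<ge> 0" using le[of z'] by (metis Re_complex_of_real minus_complex.simps(1))
  then show ?thesis using e by simp
qed

text \<open>The tangent line found on the circle supports the image of the whole closed disc: the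
  maximum modulus principle for exp(- h) carries Re h \<ge> 0 from the circle inwards, and
  \<open>Re_pos_if_Re_nonneg\<close> makes it strict.\<close>

lemma convex_disc_support:
  fixes g :: "complex \<Rightarrow> complex"
  assumes hol: "g holomorphic_on ball 0 r" and \<rho>: "0 < \<rho>" "\<rho> < r"
    and nz: "\<And>z. z \<in> ball 0 r \<Longrightarrow> deriv g z \<noteq> 0"
    and pos: "\<And>z. z \<in> ball 0 r \<Longrightarrow> Re (1 + z * deriv (deriv g) z / deriv g z) > 0"
    and w: "norm w = \<rho>"
  obtains c where "\<And>z. norm z \<le> \<rho> \<Longrightarrow> z \<noteq> w \<Longrightarrow> Re (c * (g w - g z)) > 0"
proof -
  obtain c where c: "\<And>z. norm z = \<rho> \<Longrightarrow> z \<noteq> w \<Longrightarrow> Re (c * (g w - g z)) > 0"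
    using convex_curve_tangent[OF hol \<rho> nz pos w] by blast
  have sub: "cball 0 \<rho> \<subseteq> ball (0::complex) r" using \<rho> by auto
  have gc: "continuous_on (cball 0 \<rho>) g"
    using hol sub holomorphic_on_imp_continuous_on continuous_on_subset by blast
  have gh: "g holomorphic_on ball 0 \<rho>" using hol \<rho> by (rule_tac holomorphic_on_subset) auto
  define h where "h = (\<lambda>z. c * (g w - g z))"
  have hh: "h holomorphic_on ball 0 \<rho>" unfolding h_def by (intro holomorphic_intros gh)
  have le: "Re (h z) \<ge> 0" if "z \<in> ball 0 \<rho>" for z
  proof -
    have "norm (exp (- h z)) \<le> 1"
    proof (rule maximum_modulus_frontier[of "\<lambda>z. exp (- h z)" "ball 0 \<rho>"])
      show "(\<lambda>z. exp (- h z)) holomorphic_on interior (ball 0 \<rho>)"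
        using hh by (auto intro!: holomorphic_intros)
      show "continuous_on (closure (ball 0 \<rho>)) (\<lambda>z. exp (- h z))"
        using \<rho> gc unfolding h_def by (auto intro!: continuous_intros)
      fix z :: complex assume "z \<in> frontier (ball 0 \<rho>)"
      then have "norm z = \<rho>" using \<rho> by (simp add: frontier_ball)
      then have "Re (h z) \<ge> 0" using c[of z] by (cases "z = w") (auto simp: h_def)
      then show "norm (exp (- h z)) \<le> 1" by simp
    qed (use that in auto)
    then show ?thesis by simp
  qed
  \<comment> \<open>The strict inequality at the point \<open>- w\<close> of the circle excludes c =
    0; then h'(0) = - c g'(0) shows below that \<open>h\<close> is not constant.\<close>
  have c0: "c \<noteq> 0" using c[of "- w"] w \<rho> by auto
  show thesis
  proof (rule that[of c])
    fix z assume z: "norm z \<le> \<rho>" "z \<noteq> w"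
    show "Re (c * (g w - g z)) > 0"
    proof (cases "norm z = \<rho>")
      case True then show ?thesis using c z by blast
    next
      case False
      then have zb: "z \<in> ball 0 \<rho>" using z by simp
      have "\<not> h constant_on ball 0 \<rho>"
      proof
        assume "h constant_on ball 0 \<rho>"
        then obtain y where y: "\<And>x. x \<in> ball 0 \<rho> \<Longrightarrow> h x = y" unfolding constant_on_def by blast
        have "(h has_field_derivative c * (0 - deriv g 0)) (at 0)"
          unfolding h_def using holomorphic_derivI[OF gh open_ball, of 0] \<rho>
          by (auto intro!: derivative_eq_intros)
        moreover have "(h has_field_derivative 0) (at 0)"
          by (rule has_field_derivative_transform_within_open[OF DERIV_const[of y], of "ball 0 \<rho>"])
            (use \<rho> y in auto)
        ultimately have "c * (0 - deriv g 0) = 0" by (rule DERIV_unique)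
        then show False using c0 nz[of 0] \<rho> by simp
      qed
      from Re_pos_if_Re_nonneg[OF hh open_ball connected_ball this le zb]
      show ?thesis by (simp add: h_def)
    qed
  qed
qed

text \<open>Of two distinct points, the one of larger modulus has a supporting line that strictly
  separates the images, hence injectivity. For convexity, a segment leaving the image of a smaller
  disc would meet its frontier at some g(w) with |w| = \<rho>; the supporting line there has both
  endpoints strictly on one side, although g(w) lies between them. Discs with \<rho> < r then
  exhaust the ball.\<close>

lemma convex_function_on_disc_if_Re_pos:
  fixes g :: "complex \<Rightarrow> complex"
  assumes hol: "g holomorphic_on ball 0 r" and r: "0 < r"
    and nz: "\<And>z. z \<in> ball 0 r \<Longrightarrow> deriv g z \<noteq> 0"
    and pos: "\<And>z. z \<in> ball 0 r \<Longrightarrow> Re (1 + z * deriv (deriv g) z / deriv g z) > 0"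
  shows "convex_function_on_disc g r"
proof -
  have ne: "g z \<noteq> g w" if "norm z \<le> norm w" "w \<in> ball 0 r" "z \<noteq> w" for z w
  proof -
    have "0 < norm w" using that by auto
    then obtain c where "\<And>z. norm z \<le> norm w \<Longrightarrow> z \<noteq> w \<Longrightarrow> Re (c * (g w - g z)) > 0"
      using convex_disc_support[OF hol, of "norm w" w] nz pos \<open>w \<in> ball 0 r\<close> by auto
    from this[OF that(1,3)] show ?thesis by auto
  qed
  have inj: "inj_on g (ball 0 r)"
  proof (rule inj_onI)
    fix x y assume "x \<in> ball 0 r" "y \<in> ball 0 r" "g x = g y"
    then show "x = y" using ne[of x y] ne[of y x] by (cases "norm x \<le> norm y") auto
  qed
  have cont: "continuous_on (ball 0 r) g" by (rule holomorphic_on_imp_continuous_on[OF hol])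
  have conv\<rho>: "closed_segment a b \<subseteq> g ` ball 0 \<rho>"
    if \<rho>: "0 < \<rho>" "\<rho> < r" and a: "a \<in> g ` ball 0 \<rho>" and b: "b \<in> g ` ball 0 \<rho>" for a b \<rho>
  proof (rule ccontr)
    assume n: "\<not> closed_segment a b \<subseteq> g ` ball 0 \<rho>"
    have sub: "cball 0 \<rho> \<subseteq> ball (0::complex) r" using \<rho> by auto
    have "open (g ` ball 0 \<rho>)"
      by (rule open_mapping_thm3)
        (use hol inj sub ball_subset_cball[of "0::complex" \<rho>] in
          \<open>blast intro: holomorphic_on_subset inj_on_subset\<close>)+
    have "compact (g ` cball 0 \<rho>)"
      using continuous_on_subset[OF cont sub] by (intro compact_continuous_image) auto
    then have "closure (g ` ball 0 \<rho>) \<subseteq> g ` cball 0 \<rho>"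
      by (intro closure_minimal) (auto intro: compact_imp_closed)
    \<comment> \<open>The frontier lies in the compact image of the closed disc but outside the open
      image, so only the sphere can supply its preimages.\<close>
    then have fr: "frontier (g ` ball 0 \<rho>) \<subseteq> g ` sphere 0 \<rho>"
      using \<open>open (g ` ball 0 \<rho>)\<close> by (force simp: frontier_def interior_open)
    have "closed_segment a b \<inter> frontier (g ` ball 0 \<rho>) \<noteq> {}"
      by (rule connected_Int_frontier) (use n a in auto)
    then obtain p where p: "p \<in> closed_segment a b" "p \<in> frontier (g ` ball 0 \<rho>)" by blast
    then obtain w where w: "norm w = \<rho>" "p = g w" using fr by (auto simp: subset_iff image_iff)
    obtain c where c: "\<And>z. norm z \<le> \<rho> \<Longrightarrow> z \<noteq> w \<Longrightarrow> Re (c * (g w - g z)) > 0"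
      using convex_disc_support[OF hol \<rho> nz pos w(1)] by blast
    obtain x y where xy: "a = g x" "b = g y" "norm x < \<rho>" "norm y < \<rho>" using a b by auto
    have ca: "Re (c * (p - a)) > 0" "Re (c * (p - b)) > 0"
      using c[of x] c[of y] xy w by auto
    obtain u where u: "0 \<le> u" "u \<le> 1" "p = (1 - u) *\<^sub>R a + u *\<^sub>R b"
      using p(1) by (auto simp: in_segment)
    have "(1 - u) *\<^sub>R (c * (p - a)) + u *\<^sub>R (c * (p - b)) = c * (p - ((1 - u) *\<^sub>R a + u *\<^sub>R b))"
      by (simp add: scaleR_conv_of_real algebra_simps)
    also have "\<dots> = 0" using u(3) by simp
    finally have "Re ((1 - u) *\<^sub>R (c * (p - a)) + u *\<^sub>R (c * (p - b))) = Re 0" by (rule arg_cong)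
    then have "(1 - u) * Re (c * (p - a)) + u * Re (c * (p - b)) = 0" by simp
    moreover have "(1 - u) * Re (c * (p - a)) + u * Re (c * (p - b)) > 0"
    proof (cases "u = 0")
      case False
      then show ?thesis using u ca by (intro add_nonneg_pos) auto
    qed (use ca in simp)
    ultimately show False by simp
  qed
  have "convex (g ` ball 0 r)"
    unfolding convex_contains_segment
  proof (intro ballI)
    fix a b assume "a \<in> g ` ball 0 r" "b \<in> g ` ball 0 r"
    then obtain x y where xy: "a = g x" "b = g y" "norm x < r" "norm y < r" by auto
    obtain \<rho> where \<rho>: "max (norm x) (norm y) < \<rho>" "\<rho> < r" using xy dense[of "max (norm x) (norm y)" r] by auto
    then have "0 < \<rho>" using norm_ge_zero[of x] by linarith
    then have "closed_segment a b \<subseteq> g ` ball 0 \<rho>" using xy \<rho> by (intro conv\<rho>) auto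
    also have "\<dots> \<subseteq> g ` ball 0 r" using \<rho> by (intro image_mono) auto
    finally show "closed_segment a b \<subseteq> g ` ball 0 r" .
  qed
  moreover have "open (g ` ball 0 r)" by (rule open_mapping_thm3[OF hol open_ball inj])
  ultimately show ?thesis
    unfolding convex_function_on_disc_def using hol inj convex_connected by blast
qed


section \<open>Convex image implies positive real part\<close>

lemma Schwarz_Lemma_ball:
  assumes hol: "h holomorphic_on ball 0 r" and r: "0 < r" and h0: "h 0 = 0"
    and im: "\<And>z. z \<in> ball 0 r \<Longrightarrow> h z \<in> ball 0 r" and z: "z \<in> ball 0 r"
  shows "norm (h z) \<le> norm z"
proof -
  define H where "H = (\<lambda>\<zeta>. h (of_real r * \<zeta>) / of_real r)"
  have mem: "of_real r * \<zeta> \<in> ball 0 r" if "norm \<zeta> < 1" for \<zeta> :: complex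
    using that r by (simp add: norm_mult)
  have "h \<circ> (\<lambda>\<zeta>. of_real r * \<zeta>) holomorphic_on ball 0 1"
    by (intro holomorphic_on_compose_gen[OF _ hol] holomorphic_intros) (use mem in auto)
  then have "H holomorphic_on ball 0 1"
    unfolding H_def o_def using r by (intro holomorphic_intros) auto
  moreover have "norm (H \<zeta>) < 1" if "norm \<zeta> < 1" for \<zeta>
    using im[OF mem[OF that]] r by (simp add: H_def norm_divide)
  ultimately have "norm (H (z / of_real r)) \<le> norm (z / of_real r)"
    using z r h0 by (intro Schwarz_Lemma(1)) (auto simp: H_def norm_divide)
  then show ?thesis using r by (simp add: H_def norm_divide divide_le_cancel)
qed

text \<open>If d > 0, then \<open>v'\<close> is positive just to the right of 0 and \<open>v\<close>
  rises above its maximum.\<close>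

lemma second_derivative_at_maximum:
  fixes v v' :: "real \<Rightarrow> real"
  assumes v: "\<And>t. (v has_real_derivative v' t) (at t)" and "v' 0 = 0"
    and v2: "(v' has_real_derivative d) (at 0)" and max: "\<And>t. v t \<le> v 0"
  shows "d \<le> 0"
proof (rule ccontr)
  assume "\<not> d \<le> 0"
  then obtain \<delta> where \<delta>: "\<delta> > 0" "\<And>h. 0 < h \<Longrightarrow> h < \<delta> \<Longrightarrow> v' 0 < v' (0 + h)"
    using DERIV_pos_inc_right[OF v2] by auto
  have "v 0 < v (\<delta>/2)"
  proof (rule DERIV_pos_imp_increasing_open[of 0 "\<delta>/2" v])
    show "\<exists>y. (v has_real_derivative y) (at t) \<and> 0 < y" if "0 < t" "t < \<delta>/2" for t
      using v \<delta>(2)[of t] that \<open>v' 0 = 0\<close> by auto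
    show "continuous_on {0..\<delta>/2} v" using v DERIV_isCont by (blast intro: continuous_at_imp_continuous_on)
  qed (use \<delta> in simp)
  with max[of "\<delta>/2"] show False by simp
qed

text \<open>By convexity \<open>h(\<zeta>) = g\<^sup>-\<^sup>1 ((g(\<zeta> e\<^sup>i\<^sup>\<theta>) + g(\<zeta> e\<^sup>-\<^sup>i\<^sup>\<theta>)) / 2)\<close> is a self-map of the disc fixing
  \<open>0\<close>, so \<open>\<bar>h(\<zeta>)\<bar> \<le> \<bar>\<zeta>\<bar>\<close> with equality at \<open>\<theta> = 0\<close>; the second derivative in \<open>\<theta>\<close> there is
  \<open>- (\<zeta> g'(\<zeta>) + \<zeta>\<^sup>2 g''(\<zeta>)) / g'(\<zeta>)\<close>.\<close>

lemma Re_pos_if_convex_function_on_disc: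
  fixes g :: "complex \<Rightarrow> complex"
  assumes conv: "convex_function_on_disc g r" and r: "0 < r" and g0: "g 0 = 0"
    and z: "z \<in> ball 0 r"
  shows "Re (1 + z * deriv (deriv g) z / deriv g z) > 0"
proof -
  have hol: "g holomorphic_on ball 0 r" and inj: "inj_on g (ball 0 r)"
    and op: "open (g ` ball 0 r)" and cv: "convex (g ` ball 0 r)"
    using conv unfolding convex_function_on_disc_def by auto
  have hol': "deriv g holomorphic_on ball 0 r" by (rule holomorphic_deriv[OF hol]) simp
  have hol'': "deriv (deriv g) holomorphic_on ball 0 r" by (rule holomorphic_deriv[OF hol']) simp
  have nz: "deriv g z \<noteq> 0" if "z \<in> ball 0 r" for z
    by (rule holomorphic_injective_imp_regular[OF hol open_ball inj that])
  obtain k where k: "k holomorphic_on (g ` ball 0 r)"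
    and k1: "\<And>z. z \<in> ball 0 r \<Longrightarrow> deriv g z * deriv k (g z) = 1"
    and kg: "\<And>z. z \<in> ball 0 r \<Longrightarrow> k (g z) = z"
    using holomorphic_has_inverse[OF hol open_ball inj] by metis
  have k': "deriv k holomorphic_on (g ` ball 0 r)" by (rule holomorphic_deriv[OF k op])
  have rot: "\<zeta> * cis t \<in> ball 0 r" if "\<zeta> \<in> ball 0 r" for \<zeta> t
    using that by (simp add: norm_mult)
  define W where "W = (\<lambda>\<zeta> t. (g (\<zeta> * cis t) + g (\<zeta> * cis (- t))) / 2)"
  have W_mem: "W \<zeta> t \<in> g ` ball 0 r" if "\<zeta> \<in> ball 0 r" for \<zeta> t
  proof -
    have "(1/2) *\<^sub>R g (\<zeta> * cis t) + (1/2) *\<^sub>R g (\<zeta> * cis (- t)) \<in> g ` ball 0 r"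
      by (rule convexD[OF cv]) (use rot[OF that] in auto)
    then show ?thesis by (simp add: W_def scaleR_conv_of_real add_divide_distrib)
  qed
  have k_im: "k w \<in> ball 0 r" if "w \<in> g ` ball 0 r" for w using that kg by auto
  have Schwarz: "norm (k (W \<zeta> t)) \<le> norm \<zeta>" if "\<zeta> \<in> ball 0 r" for \<zeta> t
  proof (rule Schwarz_Lemma_ball[of "\<lambda>\<zeta>. k (W \<zeta> t)" r])
    have rh: "(\<lambda>\<zeta>. g (\<zeta> * cis t)) holomorphic_on ball 0 r" for t
    proof -
      have "g \<circ> (\<lambda>\<zeta>. \<zeta> * cis t) holomorphic_on ball 0 r"
        by (intro holomorphic_on_compose_gen[OF _ hol] holomorphic_intros) (use rot in auto)
      then show ?thesis by (simp add: o_def)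
    qed
    have "k \<circ> (\<lambda>\<zeta>. W \<zeta> t) holomorphic_on ball 0 r"
    proof (rule holomorphic_on_compose_gen[OF _ k])
      show "(\<lambda>\<zeta>. W \<zeta> t) holomorphic_on ball 0 r"
        unfolding W_def by (intro holomorphic_intros rh) auto
    qed (use W_mem in auto)
    then show "(\<lambda>\<zeta>. k (W \<zeta> t)) holomorphic_on ball 0 r" by (simp add: o_def)
    show "k (W 0 t) = 0" using kg[of 0] r g0 by (simp add: W_def)
  qed (use that r k_im W_mem in blast)+
  have nonneg: "Re (1 + z * deriv (deriv g) z / deriv g z) \<ge> 0" if z: "z \<in> ball 0 r" for z
  proof (cases "z = 0")
    case False
    have \<gamma>': "((\<lambda>t. z * cis t) has_vector_derivative \<i> * (z * cis t)) (at t)" for t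
      by (rule has_vector_derivative_mult_cis)
    have chain: "((\<lambda>t. \<phi> (z * cis t)) has_vector_derivative (\<i> * (z * cis t)) * deriv \<phi> (z * cis t)) (at t)"
      if "\<phi> holomorphic_on ball 0 r" for \<phi> t
      using field_vector_diff_chain_at[OF \<gamma>' holomorphic_derivI[OF that open_ball rot[OF z]]]
      by (simp add: o_def)
    have refl: "((\<lambda>t. \<phi> (- t)) has_vector_derivative - d) (at t)"
      if "(\<phi> has_vector_derivative d) (at (- t))" for \<phi> :: "real \<Rightarrow> complex" and d t
    proof -
      have "((\<lambda>t. - t) has_vector_derivative - 1) (at t)"
        by (auto intro!: derivative_eq_intros)
      from vector_diff_chain_at[OF this that] show ?thesis by (simp add: o_def)
    qed
    define G1 where "G1 = (\<lambda>t. \<i> * (z * cis t) * deriv g (z * cis t))"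
    have G1: "((\<lambda>t. g (z * cis t)) has_vector_derivative G1 t) (at t)" for t
      unfolding G1_def by (rule chain[OF hol])
    define W1 where "W1 = (\<lambda>t. (G1 t - G1 (- t)) / 2)"
    have W1: "(W z has_vector_derivative W1 t) (at t)" for t
    proof -
      have "((\<lambda>t. (g (z * cis t) + g (z * cis (- t))) / 2) has_vector_derivative (G1 t + (- G1 (- t))) / 2) (at t)"
        using G1 refl[OF G1[of "- t"]] by (intro derivative_intros)
      then show ?thesis by (simp add: W_def[abs_def] W1_def)
    qed
    define G2 where "G2 = - (z * deriv g z + z\<^sup>2 * deriv (deriv g) z)"
    have G2: "(G1 has_vector_derivative G2) (at 0)"
    proof -
      have "(G1 has_vector_derivative (\<i> * (z * cis 0)) * ((\<i> * (z * cis 0)) * deriv (deriv g) (z * cis 0))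
          + (\<i> * (\<i> * (z * cis 0))) * deriv g (z * cis 0)) (at 0)"
        unfolding G1_def
        by (intro has_vector_derivative_mult has_vector_derivative_mult_right \<gamma>' chain[OF hol'])
      then show ?thesis by (simp add: G2_def power2_eq_square algebra_simps)
    qed
    have W2: "(W1 has_vector_derivative G2) (at 0)"
    proof -
      have "((\<lambda>t. (G1 t - G1 (- t)) / 2) has_vector_derivative (G2 - (- G2)) / 2) (at 0)"
        using G2 refl[of G1 G2 0] by (intro derivative_intros) auto
      then show ?thesis by (simp add: W1_def[abs_def])
    qed
    have Wz: "W z 0 = g z" by (simp add: W_def)
    have chain_k: "((\<lambda>t. \<phi> (W z t)) has_vector_derivative W1 t * deriv \<phi> (W z t)) (at t)"
      if "\<phi> holomorphic_on g ` ball 0 r" for \<phi> t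
      using field_vector_diff_chain_at[OF W1 holomorphic_derivI[OF that op W_mem[OF z]]]
      by (simp add: o_def)
    \<comment> \<open>A smooth substitute for the modulus: Re (\<open>cnj z\<close> * h) \<le> |z|
      |h| \<le> |z|^2, with equality at t = 0 where h = z.\<close>
    define v where "v = (\<lambda>t. Re (cnj z * k (W z t)))"
    define v' where "v' = (\<lambda>t. Re (cnj z * (W1 t * deriv k (W z t))))"
    \<comment> \<open>\<open>W z\<close> is even in \<open>t\<close>, so \<open>W1 0\<close> is 0:
      the term with the second derivative of \<open>k\<close> drops out and only
      \<open>G2 * deriv k (g z)\<close> survives.\<close>
    have "Re (cnj z * (W1 0 * (W1 0 * deriv (deriv k) (W z 0)) + G2 * deriv k (W z 0))) \<le> 0"
    proof (rule second_derivative_at_maximum[of v v'])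
      show "(v has_real_derivative v' t) (at t)" for t
        unfolding has_real_derivative_iff_has_vector_derivative v_def v'_def
        by (intro bounded_linear.has_vector_derivative[OF bounded_linear_Re]
            has_vector_derivative_mult_right chain_k[OF k])
      show "(v' has_real_derivative
          Re (cnj z * (W1 0 * (W1 0 * deriv (deriv k) (W z 0)) + G2 * deriv k (W z 0)))) (at 0)"
        unfolding has_real_derivative_iff_has_vector_derivative v'_def
        by (intro bounded_linear.has_vector_derivative[OF bounded_linear_Re]
            has_vector_derivative_mult_right has_vector_derivative_mult W2 chain_k[OF k'])
      show "v' 0 = 0" by (simp add: v'_def W1_def)
      fix t
      have "v t \<le> norm (cnj z * k (W z t))" unfolding v_def by (rule complex_Re_le_cmod)
      also have "\<dots> \<le> norm z * norm z" using Schwarz[OF z] by (simp add: norm_mult mult_left_mono)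
      also have "\<dots> = v 0"
        using kg[OF z] cmod_power2[of z] by (simp add: v_def Wz power2_eq_square)
      finally show "v t \<le> v 0" .
    qed
    then have le: "Re (cnj z * (G2 * deriv k (g z))) \<le> 0" by (simp add: Wz W1_def)
    define P where "P = 1 + z * deriv (deriv g) z / deriv g z"
    have "deriv k (g z) = 1 / deriv g z"
      using k1[OF z] nz[OF z] by (simp add: field_simps)
    then have "cnj z * (G2 * deriv k (g z)) = - ((z * cnj z) * P)"
      using nz[OF z] by (simp add: G2_def P_def field_simps power2_eq_square)
    then have "Re (cnj z * (G2 * deriv k (g z))) = Re (- (of_real ((norm z)\<^sup>2) * P))"
      unfolding complex_norm_square by (rule arg_cong)
    also have "\<dots> = - ((norm z)\<^sup>2 * Re P)" by (simp del: of_real_power)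
    finally have "(norm z)\<^sup>2 * Re P \<ge> 0" using le by simp
    then have "Re P \<ge> 0" using False by (simp add: zero_le_mult_iff)
    then show ?thesis unfolding P_def .
  qed simp
  \<comment> \<open>Strictness: \<open>p\<close> is 1 at the origin, so it is either constantly 1 or
    nonconstant, and then the open mapping argument applies.\<close>
  define p where "p = (\<lambda>z. 1 + z * deriv (deriv g) z / deriv g z)"
  have p: "p holomorphic_on ball 0 r"
    unfolding p_def using nz by (intro holomorphic_intros hol' hol'') auto
  have "Re (p z) > 0"
  proof (cases "p constant_on ball 0 r")
    case True
    then have "p z = p 0" using z r unfolding constant_on_def by force
    moreover have "p 0 = 1" by (simp add: p_def)
    ultimately show ?thesis by simp
  next
    case False
    show ?thesis
      by (rule Re_pos_if_Re_nonneg[OF p open_ball connected_ball False _ z]) (use nonneg in \<open>simp add: p_def\<close>)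
  qed
  then show ?thesis by (simp add: p_def)
qed

subsection \<open>Radial maps\<close>

text \<open>Both DF(x) and its Sherman-Morrison inverse have this shape.\<close>

lemma bounded_clinear_rank_one_update:
  fixes L :: "'a::complex_normed_vector \<Rightarrow> complex"
  assumes L: "bounded_clinear L"
  shows "bounded_clinear (\<lambda>h. a *\<^sub>C h + L h *\<^sub>C y)"
proof -
  have "bounded_linear (\<lambda>h. a *\<^sub>C h + L h *\<^sub>C y)"
    using bounded_clinearD(1)[OF L]
    by (intro bounded_linear_add scaleC.bounded_linear_right
        bounded_linear_compose[OF scaleC.bounded_linear_left])
  then show ?thesis
    using bounded_clinear_complexD[OF L]
    by (simp add: bounded_clinear_def scaleC_add_right scaleC_scaleC mult.commute)
qed

text \<open>\<open>A\<close> is multiplication by \<open>a\<close> on the kernel of \<open>L\<close>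
  and multiplies \<open>y\<close> by \<open>a + L y\<close>, whence the two conditions. For DF at x
  = \<zeta> u these numbers are f(x) and f_u'(\<zeta>).\<close>

lemma rank_one_update_inverse:
  fixes L :: "'a::complex_normed_vector \<Rightarrow> complex"
  assumes L: "bounded_clinear L" and nz: "a \<noteq> 0" "a + L y \<noteq> 0"
  defines "A \<equiv> (\<lambda>h. a *\<^sub>C h + L h *\<^sub>C y)"
  shows "bij A" "bounded_clinear (inv A)"
proof -
  define s where "s = a + L y"
  \<comment> \<open>the Sherman-Morrison formula\<close>
  define I where "I = (\<lambda>w. (1/a) *\<^sub>C w + (- L w / (a * s)) *\<^sub>C y)"
  note LC = bounded_clinear_complexD[OF L]
  note Ladd = linear_add[OF bounded_linear.linear[OF bounded_clinearD(1)[OF L]]]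
  have s: "s \<noteq> 0" "L y = s - a" using nz by (simp_all add: s_def)
  have AI: "A (I w) = w" for w
  proof -
    have "L (I w) = L w / s"
      using nz s(1) by (simp add: I_def Ladd LC s(2) field_simps)
    moreover have "a *\<^sub>C I w = w + (- L w / s) *\<^sub>C y"
      using nz s(1) by (simp add: I_def scaleC_add_right scaleC_scaleC)
    ultimately show ?thesis
      by (simp add: A_def add.assoc flip: scaleC_add_left)
  qed
  have IA: "I (A h) = h" for h
  proof -
    have "L (A h) = L h * s" by (simp add: A_def Ladd LC s(2) algebra_simps)
    then have "I (A h) = (1/a) *\<^sub>C A h + (- L h / a) *\<^sub>C y"
      using s(1) by (simp add: I_def)
    also have "\<dots> = h + ((L h / a) *\<^sub>C y + (- L h / a) *\<^sub>C y)"
      using nz by (simp add: A_def scaleC_add_right scaleC_scaleC)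
    also have "\<dots> = h" by (simp flip: scaleC_add_left)
    finally show ?thesis .
  qed
  show "bij A" by (rule o_bij[of I A]) (use AI IA in \<open>auto simp: fun_eq_iff\<close>)
  have "inv A = I" by (rule inv_unique_comp) (use AI IA in \<open>auto simp: fun_eq_iff\<close>)
  moreover have "bounded_clinear (\<lambda>w. - L w / (a * s))"
    using bounded_linear_const_mult[OF bounded_clinearD(1)[OF L], of "- 1 / (a * s)"]
    by (simp add: bounded_clinear_def LC scaleC_complex_def)
  then have "bounded_clinear I"
    unfolding I_def by (rule bounded_clinear_rank_one_update)
  ultimately show "bounded_clinear (inv A)" by simp
qed

section \<open>Derivatives of the radial map along complex lines\<close>

context
  fixes f :: "'a::complex_banach \<Rightarrow> complex" and F :: "'a \<Rightarrow> 'a"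
  assumes f_hol: "banach_holomorphic_on f (ball 0 1)"
    and F_eq: "\<And>x. x \<in> ball 0 1 \<Longrightarrow> F x = f x *\<^sub>C x"
begin

lemma has_derivative_radial_map:
  assumes y: "y \<in> ball 0 1"
  shows "(F has_derivative (\<lambda>h. f y *\<^sub>C h + frechet_D f y h *\<^sub>C y)) (at y)"
proof -
  have "((\<lambda>y. f y *\<^sub>C y) has_derivative (\<lambda>h. f y *\<^sub>C h + frechet_D f y h *\<^sub>C y)) (at y)"
    by (rule scaleC.FDERIV[OF banach_holomorphic_onD(1)[OF f_hol open_ball y] has_derivative_ident])
  then show ?thesis
    by (rule has_derivative_transform_within_open[OF _ open_ball y]) (simp add: F_eq)
qed

lemma frechet_D_radial_map:
  assumes y: "y \<in> ball 0 1"
  shows "frechet_D F y = (\<lambda>h. f y *\<^sub>C h + frechet_D f y h *\<^sub>C y)"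
  by (rule frechet_derivative_at[OF has_derivative_radial_map[OF y], symmetric])

lemma banach_holomorphic_radial_map:
  assumes "r \<le> 1"
  shows "banach_holomorphic_on F (ball 0 r)"
  unfolding banach_holomorphic_on_def
proof
  fix x :: 'a assume "x \<in> ball 0 r"
  then have x: "x \<in> ball 0 1" using assms by auto
  show "\<exists>L. bounded_clinear L \<and> (F has_derivative L) (at x within ball 0 r)"
    using bounded_clinear_rank_one_update[OF banach_holomorphic_onD(2)[OF f_hol open_ball x]]
      has_derivative_at_withinI[OF has_derivative_radial_map[OF x]] by blast
qed

text \<open>In the space of bounded operators DF(y) is f(y) times the identity plus the composition
  of Df(y) with c -> c y. Composition is bounded bilinear, so the product rule reduces the claim to
  \<open>frechet_D_differentiable\<close>.\<close>

lemma Blinfun_frechet_D_radial_map_differentiable: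
  assumes x: "x \<in> ball 0 1"
  shows "(\<lambda>y. Blinfun (frechet_D F y)) differentiable (at x)"
proof -
  obtain B where B: "((\<lambda>y. Blinfun (frechet_D f y)) has_derivative B) (at x)"
    using frechet_D_differentiable[OF f_hol open_ball x] by (auto simp: differentiable_def)
  note R = bounded_linear.has_derivative[OF scaleC.bounded_linear_prod_right
      banach_holomorphic_onD(1)[OF f_hol open_ball x]]
  note L = bounded_bilinear.FDERIV[OF bounded_bilinear_blinfun_compose
      bounded_linear.has_derivative[OF scaleC.bounded_linear_prod_left has_derivative_ident] B]
  have eq: "Blinfun (frechet_D F y) = scaleC.prod_right (f y) + (scaleC.prod_left y o\<^sub>L Blinfun (frechet_D f y))"
    if y: "y \<in> ball 0 1" for y
  proof (rule blinfun_eqI)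
    fix h
    note c = banach_holomorphic_onD(2)[OF f_hol open_ball y]
    show "blinfun_apply (Blinfun (frechet_D F y)) h =
        blinfun_apply (scaleC.prod_right (f y) + (scaleC.prod_left y o\<^sub>L Blinfun (frechet_D f y))) h"
      unfolding frechet_D_radial_map[OF y]
      using bounded_linear_Blinfun_apply[OF bounded_clinearD(1)[OF bounded_clinear_rank_one_update[OF c]]]
        bounded_linear_Blinfun_apply[OF bounded_clinearD(1)[OF c]]
      by (simp add: blinfun.add_left scaleC.prod_left.rep_eq scaleC.prod_right.rep_eq)
  qed
  show ?thesis
    unfolding differentiable_def
    by (rule exI, rule has_derivative_transform_within_open[OF has_derivative_add[OF R L] open_ball x])
      (rule eq[symmetric])
qed

abbreviation (input) slice :: "'a \<Rightarrow> complex \<Rightarrow> complex" where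
  "slice u \<equiv> (\<lambda>\<zeta>. \<zeta> * f (\<zeta> *\<^sub>C u))"

lemma
  assumes u: "norm u = 1" and \<zeta>: "\<zeta> \<in> ball 0 1"
  shows scaleC_mem_ball: "\<zeta> *\<^sub>C u \<in> ball 0 1"
    and has_field_derivative_slice:
      "(slice u has_field_derivative f (\<zeta> *\<^sub>C u) + frechet_D f (\<zeta> *\<^sub>C u) (\<zeta> *\<^sub>C u)) (at \<zeta>)"
proof -
  show mem: "\<zeta> *\<^sub>C u \<in> ball 0 1" using u \<zeta> by (simp add: norm_scaleC)
  have "((\<lambda>s. f (s *\<^sub>C u)) has_field_derivative frechet_D f (\<zeta> *\<^sub>C u) u) (at \<zeta>)"
    using banach_holomorphic_line_deriv[OF f_hol open_ball, of 0 \<zeta> u] mem by simp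
  from DERIV_mult[OF DERIV_ident this]
  show "(slice u has_field_derivative f (\<zeta> *\<^sub>C u) + frechet_D f (\<zeta> *\<^sub>C u) (\<zeta> *\<^sub>C u)) (at \<zeta>)"
    by (simp add: bounded_clinear_complexD[OF banach_holomorphic_onD(2)[OF f_hol open_ball mem]] mult.commute)
qed

lemma deriv_slice:
  assumes "norm u = 1" "\<zeta> \<in> ball 0 1"
  shows "deriv (slice u) \<zeta> = f (\<zeta> *\<^sub>C u) + frechet_D f (\<zeta> *\<^sub>C u) (\<zeta> *\<^sub>C u)"
  by (rule DERIV_imp_deriv[OF has_field_derivative_slice[OF assms]])

lemma slice_holomorphic:
  assumes "norm u = 1"
  shows "slice u holomorphic_on ball 0 1"
  using has_field_derivative_slice[OF assms] by (subst holomorphic_on_open) blast+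

text \<open>The factor \<open>c\<close> is kept independent of \<open>\<zeta>\<close>: later uses
  take it to be \<open>\<zeta>\<close>, a multiple of \<open>\<zeta>\<close>, and 0 or 1.\<close>

lemma frechet_D_radial_map_line:
  assumes u: "norm u = 1" and \<zeta>: "\<zeta> \<in> ball 0 1"
  shows "frechet_D F (\<zeta> *\<^sub>C u) (c *\<^sub>C u) = (c * deriv (slice u) \<zeta>) *\<^sub>C u"
proof -
  note mem = scaleC_mem_ball[OF u \<zeta>]
  note LC = bounded_clinear_complexD[OF banach_holomorphic_onD(2)[OF f_hol open_ball mem]]
  show ?thesis
    unfolding frechet_D_radial_map[OF mem] deriv_slice[OF u \<zeta>]
    by (simp add: LC scaleC_scaleC algebra_simps flip: scaleC_add_left)
qed

text \<open>With the vector \<open>\<zeta> *\<^sub>C u\<close> held fixed, t -> DF(t u)(\<zeta> u)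
  is \<zeta> f_u'(t) u. Its derivative at \<open>\<zeta>\<close>, computed directly and by the chain
  rule through D^2 F, must agree; the increment s = \<zeta> gives the formula.\<close>

lemma frechet_D2_radial_map:
  assumes u: "norm u = 1" and \<zeta>: "\<zeta> \<in> ball 0 1"
  shows "frechet_D2 F (\<zeta> *\<^sub>C u) (\<zeta> *\<^sub>C u) (\<zeta> *\<^sub>C u) = (\<zeta>\<^sup>2 * deriv (deriv (slice u)) \<zeta>) *\<^sub>C u"
proof -
  note mem = scaleC_mem_ball[OF u \<zeta>]
  define B where "B = frechet_derivative (\<lambda>y. Blinfun (frechet_D F y)) (at (\<zeta> *\<^sub>C u))"
  have B: "((\<lambda>y. Blinfun (frechet_D F y)) has_derivative B) (at (\<zeta> *\<^sub>C u))"
    unfolding B_def using Blinfun_frechet_D_radial_map_differentiable[OF mem]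
    by (simp add: frechet_derivative_works)
  have line: "((\<lambda>t. t *\<^sub>C u) has_derivative (\<lambda>s. s *\<^sub>C u)) (at \<zeta>)"
    by (rule bounded_linear_imp_has_derivative[OF scaleC.bounded_linear_left])
  have "((\<lambda>t. blinfun_apply (Blinfun (frechet_D F (t *\<^sub>C u))) (\<zeta> *\<^sub>C u))
      has_derivative (\<lambda>s. blinfun_apply (B (s *\<^sub>C u)) (\<zeta> *\<^sub>C u))) (at \<zeta>)"
    by (rule bounded_linear.has_derivative[OF blinfun.bounded_linear_left
          diff_chain_at[OF line B, unfolded o_def]])
  then have 1: "((\<lambda>t. (\<zeta> * deriv (slice u) t) *\<^sub>C u)
      has_derivative (\<lambda>s. blinfun_apply (B (s *\<^sub>C u)) (\<zeta> *\<^sub>C u))) (at \<zeta>)"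
  proof (rule has_derivative_transform_within_open[OF _ open_ball \<zeta>])
    fix t :: complex assume t: "t \<in> ball 0 1"
    note c = banach_holomorphic_onD(2)[OF banach_holomorphic_radial_map[OF order_refl] open_ball
        scaleC_mem_ball[OF u t]]
    show "blinfun_apply (Blinfun (frechet_D F (t *\<^sub>C u))) (\<zeta> *\<^sub>C u) = (\<zeta> * deriv (slice u) t) *\<^sub>C u"
      unfolding bounded_linear_Blinfun_apply[OF bounded_clinearD(1)[OF c]]
      by (rule frechet_D_radial_map_line[OF u t])
  qed
  have "(deriv (slice u) has_field_derivative deriv (deriv (slice u)) \<zeta>) (at \<zeta>)"
    by (rule holomorphic_derivI[OF holomorphic_deriv[OF slice_holomorphic[OF u]] open_ball \<zeta>]) simp
  then have "((\<lambda>t. \<zeta> * deriv (slice u) t) has_derivative (\<lambda>s. \<zeta> * deriv (deriv (slice u)) \<zeta> * s)) (at \<zeta>)"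
    unfolding has_field_derivative_def[symmetric] by (rule DERIV_cmult)
  from bounded_linear.has_derivative[OF scaleC.bounded_linear_left this, of u]
  have "(\<lambda>s. blinfun_apply (B (s *\<^sub>C u)) (\<zeta> *\<^sub>C u)) = (\<lambda>s. (\<zeta> * deriv (deriv (slice u)) \<zeta> * s) *\<^sub>C u)"
    by (rule has_derivative_unique[OF 1])
  from fun_cong[OF this, of \<zeta>] show ?thesis
    unfolding frechet_D2_def B_def[symmetric] by (simp add: power2_eq_square mult_ac)
qed

text \<open>The argument of the inverse is DF applied to a multiple q of x = \<zeta> u, so
  injectivity alone evaluates the inverse. Then l(q x) = q |x| for every support functional,
  whatever its values off the line.\<close>

lemma support_functional_quotient:
  assumes u: "norm u = 1" and \<zeta>: "\<zeta> \<in> ball 0 1" and nz: "deriv (slice u) \<zeta> \<noteq> 0"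
    and bij: "bij (frechet_D F (\<zeta> *\<^sub>C u))" and l: "l \<in> support_functionals (\<zeta> *\<^sub>C u)"
  shows "Re (l (inv (frechet_D F (\<zeta> *\<^sub>C u))
      (frechet_D2 F (\<zeta> *\<^sub>C u) (\<zeta> *\<^sub>C u) (\<zeta> *\<^sub>C u) + frechet_D F (\<zeta> *\<^sub>C u) (\<zeta> *\<^sub>C u))))
    = norm \<zeta> * Re (1 + \<zeta> * deriv (deriv (slice u)) \<zeta> / deriv (slice u) \<zeta>)"
proof -
  define q where "q = 1 + \<zeta> * deriv (deriv (slice u)) \<zeta> / deriv (slice u) \<zeta>"
  have "frechet_D2 F (\<zeta> *\<^sub>C u) (\<zeta> *\<^sub>C u) (\<zeta> *\<^sub>C u) + frechet_D F (\<zeta> *\<^sub>C u) (\<zeta> *\<^sub>C u)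
      = (\<zeta>\<^sup>2 * deriv (deriv (slice u)) \<zeta> + \<zeta> * deriv (slice u) \<zeta>) *\<^sub>C u"
    by (simp only: frechet_D2_radial_map[OF u \<zeta>] frechet_D_radial_map_line[OF u \<zeta>] scaleC_add_left)
  also have "\<zeta>\<^sup>2 * deriv (deriv (slice u)) \<zeta> + \<zeta> * deriv (slice u) \<zeta> = (q * \<zeta>) * deriv (slice u) \<zeta>"
    using nz by (simp add: q_def field_simps power2_eq_square)
  also have "\<dots> *\<^sub>C u = frechet_D F (\<zeta> *\<^sub>C u) ((q * \<zeta>) *\<^sub>C u)"
    by (simp only: frechet_D_radial_map_line[OF u \<zeta>])
  finally have "inv (frechet_D F (\<zeta> *\<^sub>C u))
      (frechet_D2 F (\<zeta> *\<^sub>C u) (\<zeta> *\<^sub>C u) (\<zeta> *\<^sub>C u) + frechet_D F (\<zeta> *\<^sub>C u) (\<zeta> *\<^sub>C u))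
    = q *\<^sub>C \<zeta> *\<^sub>C u"
    using bij by (simp add: inv_f_f bij_is_inj scaleC_scaleC)
  moreover have "l (q *\<^sub>C \<zeta> *\<^sub>C u) = q * of_real (norm \<zeta>)"
  proof -
    have "bounded_clinear l" "l (\<zeta> *\<^sub>C u) = of_real (norm \<zeta>)"
      using l u by (auto simp: support_functionals_def norm_scaleC)
    then show ?thesis using bounded_clinear_complexD[of l q "\<zeta> *\<^sub>C u"] by simp
  qed
  moreover have "Re (q * of_real (norm \<zeta>)) = norm \<zeta> * Re q" by simp
  ultimately show ?thesis unfolding q_def[symmetric] by simp
qed

text \<open>The hypothesis quantifies over support functionals, so one must exist before it yields
  an inequality on the slice; this is where Hahn-Banach enters.\<close>

lemma slice_convex_if_quasi_convex:
  assumes r: "0 < r" "r < 1" and qc: "quasi_convex_type_B F r"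
    and u: "norm u = 1"
  shows "convex_function_on_disc (slice u) r"
proof (rule convex_function_on_disc_if_Re_pos)
  have sub: "ball 0 r \<subseteq> ball (0::complex) 1" using r by auto
  show "slice u holomorphic_on ball 0 r"
    by (rule holomorphic_on_subset[OF slice_holomorphic[OF u] sub])
  have bij: "bij (frechet_D F (\<zeta> *\<^sub>C u))" if "\<zeta> \<in> ball 0 r" for \<zeta>
    using qc that u unfolding quasi_convex_type_B_def locally_biholomorphic_on_def
    by (simp add: norm_scaleC)
  show nz: "deriv (slice u) \<zeta> \<noteq> 0" if \<zeta>: "\<zeta> \<in> ball 0 r" for \<zeta>
  proof
    assume "deriv (slice u) \<zeta> = 0"
    moreover have "\<zeta> \<in> ball 0 1" using \<zeta> sub by blast
    ultimately have "frechet_D F (\<zeta> *\<^sub>C u) (1 *\<^sub>C u) = frechet_D F (\<zeta> *\<^sub>C u) (0 *\<^sub>C u)"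
      by (simp only: frechet_D_radial_map_line[OF u] mult_zero_right)
    then have "1 *\<^sub>C u = 0 *\<^sub>C u" using bij[OF \<zeta>] by (meson bij_is_inj injD)
    then show False using u by auto
  qed
  fix \<zeta> assume \<zeta>: "\<zeta> \<in> ball (0::complex) r"
  \<comment> \<open>Quasi-convexity says nothing at the origin, but there the expression equals
    1.\<close>
  show "Re (1 + \<zeta> * deriv (deriv (slice u)) \<zeta> / deriv (slice u) \<zeta>) > 0"
  proof (cases "\<zeta> = 0")
    case False
    have "norm (\<zeta> *\<^sub>C u) = norm \<zeta>" using u by (simp add: norm_scaleC)
    then have x: "\<zeta> *\<^sub>C u \<noteq> 0" "\<zeta> *\<^sub>C u \<in> ball 0 r"
      using False \<zeta> by (metis norm_eq_zero, simp)
    obtain l where l: "l \<in> support_functionals (\<zeta> *\<^sub>C u)" using support_functional_exists[OF x(1)] .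
    have "Re (l (inv (frechet_D F (\<zeta> *\<^sub>C u))
      (frechet_D2 F (\<zeta> *\<^sub>C u) (\<zeta> *\<^sub>C u) (\<zeta> *\<^sub>C u) + frechet_D F (\<zeta> *\<^sub>C u) (\<zeta> *\<^sub>C u)))) > 0"
      using qc x l unfolding quasi_convex_type_B_def by blast
    moreover have "\<zeta> \<in> ball 0 1" using \<zeta> sub by blast
    ultimately have "norm \<zeta> * Re (1 + \<zeta> * deriv (deriv (slice u)) \<zeta> / deriv (slice u) \<zeta>) > 0"
      by (simp only: support_functional_quotient[OF u _ nz[OF \<zeta>] bij[OF \<zeta>] l])
    then show ?thesis by (simp only: zero_less_mult_iff) simp
  qed simp
qed (rule r)

lemma quasi_convex_if_slices_convex:
  assumes f0: "f 0 = 1" and r: "0 < r" "r < 1"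
    and conv: "\<And>u. norm u = 1 \<Longrightarrow> convex_function_on_disc (slice u) r"
  shows "quasi_convex_type_B F r"
proof -
  have norm: "normalized_map F"
    using F_eq[of 0] frechet_D_radial_map[of 0] f0 by (auto simp: normalized_map_def fun_eq_iff)
  have polar: "\<exists>u \<zeta>. norm u = 1 \<and> \<zeta> \<in> ball 0 r \<and> \<zeta> \<noteq> 0 \<and> x = \<zeta> *\<^sub>C u"
    if "x \<in> ball 0 r" "x \<noteq> 0" for x :: 'a
  proof (intro exI conjI)
    show "x = of_real (norm x) *\<^sub>C of_real (1 / norm x) *\<^sub>C x"
      using that by (simp add: scaleC_scaleC)
  qed (use that in \<open>auto simp: norm_scaleC norm_divide\<close>)
  have nz: "f (\<zeta> *\<^sub>C u) \<noteq> 0" "deriv (slice u) \<zeta> \<noteq> 0"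
    if u: "norm u = 1" and \<zeta>: "\<zeta> \<in> ball 0 r" "\<zeta> \<noteq> 0" for u \<zeta>
  proof -
    have hol: "slice u holomorphic_on ball 0 r" and inj: "inj_on (slice u) (ball 0 r)"
      using conv[OF u] unfolding convex_function_on_disc_def by auto
    \<comment> \<open>The slice vanishes at 0, so a zero of \<open>f\<close> here would give 0 a
      second preimage.\<close>
    show "f (\<zeta> *\<^sub>C u) \<noteq> 0"
      using inj_onD[OF inj, of \<zeta> 0] \<zeta> r by auto
    show "deriv (slice u) \<zeta> \<noteq> 0"
      by (rule holomorphic_injective_imp_regular[OF hol open_ball inj \<zeta>(1)])
  qed
  have inv: "bij (frechet_D F x)" "bounded_clinear (inv (frechet_D F x))" if x: "x \<in> ball 0 r" for x
  proof -
    have x1: "x \<in> ball 0 1" using x r by auto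
    note c = banach_holomorphic_onD(2)[OF f_hol open_ball x1]
    have "f x \<noteq> 0 \<and> f x + frechet_D f x x \<noteq> 0"
    proof (cases "x = 0")
      case True
      then show ?thesis using f0 bounded_clinear_complexD[OF c, of 0 0] by simp
    next
      case False
      then obtain u \<zeta> where "norm u = 1" "\<zeta> \<in> ball 0 r" "\<zeta> \<noteq> 0" "x = \<zeta> *\<^sub>C u"
        using polar[OF x] by blast
      then show ?thesis using nz[of u \<zeta>] deriv_slice[of u \<zeta>] r by simp
    qed
    then show "bij (frechet_D F x)" "bounded_clinear (inv (frechet_D F x))"
      unfolding frechet_D_radial_map[OF x1] using rank_one_update_inverse[OF c] by auto
  qed
  have "Re (l (inv (frechet_D F x) (frechet_D2 F x x x + frechet_D F x x))) > 0"
    if x: "x \<in> ball 0 r - {0}" and l: "l \<in> support_functionals x" for x l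
  proof -
    obtain u \<zeta> where u: "norm u = 1" and \<zeta>: "\<zeta> \<in> ball 0 r" "\<zeta> \<noteq> 0" and x_eq: "x = \<zeta> *\<^sub>C u"
      using polar x by blast
    have \<zeta>1: "\<zeta> \<in> ball 0 1" using \<zeta> r by auto
    have "bij (frechet_D F (\<zeta> *\<^sub>C u))" using inv(1) x x_eq by blast
    note q = support_functional_quotient[OF u \<zeta>1 nz(2)[OF u \<zeta>] this l[unfolded x_eq]]
    have "Re (1 + \<zeta> * deriv (deriv (slice u)) \<zeta> / deriv (slice u) \<zeta>) > 0"
      by (rule Re_pos_if_convex_function_on_disc[OF conv[OF u] r(1) _ \<zeta>(1)]) simp
    then show ?thesis
      unfolding x_eq q using \<zeta>(2) by (intro mult_pos_pos) auto
  qed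
  then show ?thesis
    unfolding quasi_convex_type_B_def locally_biholomorphic_on_def
    using norm banach_holomorphic_radial_map inv r by auto
qed

end

theorem theorem3p3:
  fixes f :: "'a::complex_banach \<Rightarrow> complex"
    and F :: "'a \<Rightarrow> 'a"
    and r :: real
  assumes f_hol: "banach_holomorphic_on f (ball 0 1)"
    and f0: "f 0 = 1"
    and F_eq: "\<And>x. x \<in> ball 0 1 \<Longrightarrow> F x = f x *\<^sub>C x"
    and r: "0 < r" "r < 1"
  shows "quasi_convex_type_B F r \<longleftrightarrow>
    (\<forall>u \<in> sphere 0 1. convex_function_on_disc (\<lambda>\<zeta>. \<zeta> * f (\<zeta> *\<^sub>C u)) r)"
  using slice_convex_if_quasi_convex[OF f_hol F_eq r]
    quasi_convex_if_slices_convex[OF f_hol F_eq f0 r]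
  by auto

end
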